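(* Let $k\ge 0$ be an integer and let $G$ be a graph of order $n\ge 5k+6$, where $n\equiv k \pmod 2$. If $\rho(G)\ge \rho(K_2\vee ((k+1)K_1\cup K_{n-k-3}))$, then for every edge $e$ of $G$, $G$ has a matching of size $\frac{n-k}{2}$ containing $e$, unless $G\cong K_2\vee ((k+1)K_1\cup K_{n-k-3})$.
   Context: All graphs are finite, simple and undirected. $\rho(G)$ denotes the spectral radius (largest eigenvalue) of the adjacency matrix of $G$. $K_m$ is the complete graph on $m$ vertices, $mH$ is the disjoint union of $m$ copies of $H$, $G_1\cup G_2$ is the disjoint union, and $G_1\vee G_2$ is the join (disjoint union plus all edges between $V(G_1)$ and $V(G_2)$). *)

theory Defs
  imports
    "Graph_Theory.Pair_Digraph"
    "Graph_Theory.Digraph_Isomorphism"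
    "Graph_Theory.Kuratowski"
    "Jordan_Normal_Form.Spectral_Radius"
    "HOL-Number_Theory.Cong"
begin

text \<open>
  A finite simple undirected graph is a \<^locale>\<open>pair_graph\<close>: a finite, loop-free digraph whose
  arc set is a symmetric set of ordered pairs. An undirected edge \<open>{u, v}\<close> is thus represented
  by the two arcs \<open>(u, v)\<close> and \<open>(v, u)\<close>; \<open>edges\<close> identifies them.
\<close>

definition edges :: "'a pair_pre_digraph \<Rightarrow> 'a set set" where
  "edges G = {{u, v} | u v. (u, v) \<in> parcs G}"

definition matching :: "'a pair_pre_digraph \<Rightarrow> 'a set set \<Rightarrow> bool" where
  "matching G M \<longleftrightarrow> M \<subseteq> edges G \<and> (\<forall>e \<in> M. \<forall>f \<in> M. e \<noteq> f \<longrightarrow> e \<inter> f = {})"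

definition complete_graph :: "nat \<Rightarrow> nat pair_pre_digraph" where
  "complete_graph m = \<lparr>pverts = {..<m}, parcs = {(u, v). u < m \<and> v < m \<and> u \<noteq> v}\<rparr>"

definition copies :: "nat \<Rightarrow> 'a pair_pre_digraph \<Rightarrow> (nat \<times> 'a) pair_pre_digraph" where
  "copies m H = \<lparr>pverts = {..<m} \<times> pverts H,
                 parcs = {((i, u), (i, v)) | i u v. i < m \<and> (u, v) \<in> parcs H}\<rparr>"

definition disjoint_union ::
    "'a pair_pre_digraph \<Rightarrow> 'b pair_pre_digraph \<Rightarrow> ('a + 'b) pair_pre_digraph" where
  "disjoint_union G H = \<lparr>pverts = pverts G <+> pverts H,
     parcs = {(Inl u, Inl v) | u v. (u, v) \<in> parcs G} \<union> {(Inr u, Inr v) | u v. (u, v) \<in> parcs H}\<rparr>"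

definition graph_join ::
    "'a pair_pre_digraph \<Rightarrow> 'b pair_pre_digraph \<Rightarrow> ('a + 'b) pair_pre_digraph" where
  "graph_join G H = \<lparr>pverts = pverts (disjoint_union G H),
     parcs = parcs (disjoint_union G H)
       \<union> {(Inl u, Inr v) | u v. u \<in> pverts G \<and> v \<in> pverts H}
       \<union> {(Inr v, Inl u) | u v. u \<in> pverts G \<and> v \<in> pverts H}\<rparr>"

abbreviation graph_iso :: "'a pair_pre_digraph \<Rightarrow> 'b pair_pre_digraph \<Rightarrow> bool" where
  "graph_iso G H \<equiv> digraph_iso (with_proj G) (with_proj H)"

text \<open>
  The list \<open>vs\<close> enumerates the vertices, fixing the order of rows and columns. The entries are
  complex because \<^const>\<open>spectral_radius\<close>, the largest modulus of an eigenvalue, is defined for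
  complex matrices. For an adjacency matrix it coincides with the largest eigenvalue
  (Perron--Frobenius).
\<close>

definition adjacency_matrix :: "'a list \<Rightarrow> 'a pair_pre_digraph \<Rightarrow> complex mat" where
  "adjacency_matrix vs G =
     mat (length vs) (length vs) (\<lambda>(i, j). if (vs ! i, vs ! j) \<in> parcs G then 1 else 0)"

text \<open>The enumeration chosen here is irrelevant, see \<open>rho_eq\<close> below.\<close>

definition rho :: "'a pair_pre_digraph \<Rightarrow> real" where
  "rho G = spectral_radius
     (adjacency_matrix (SOME vs. distinct vs \<and> set vs = pverts G) G)"

definition extremal_graph :: "nat \<Rightarrow> nat \<Rightarrow> (nat + (nat \<times> nat) + nat) pair_pre_digraph" where
  "extremal_graph n k =
     graph_join (complete_graph 2)
       (disjoint_union (copies (k + 1) (complete_graph 1)) (complete_graph (n - k - 3)))"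

lemma spectrum_adjacency_matrix_subset:
  assumes "distinct vs" "distinct ws" "set vs = set ws"
  shows "spectrum (adjacency_matrix vs G) \<subseteq> spectrum (adjacency_matrix ws G)"
proof
  fix c assume "c \<in> spectrum (adjacency_matrix vs G)"
  define n where "n = length vs"
  have n: "length vs = n" "length ws = n"
    using assms by (auto simp: n_def) (metis distinct_card)
  have bv: "bij_betw ((!) vs) {..<n} (set vs)" and bw: "bij_betw ((!) ws) {..<n} (set vs)"
    using assms n by (auto intro!: bij_betw_nth)
  define p where "p = the_inv_into {..<n} ((!) vs) \<circ> (!) ws"
  have p: "bij_betw p {..<n} {..<n}"
    unfolding p_def by (rule bij_betw_trans[OF bw bij_betw_the_inv_into[OF bv]])
  have pn: "p i < n" if "i < n" for i
    using p that by (auto simp: bij_betw_def)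
  have vp: "vs ! (p i) = ws ! i" if "i < n" for i
    unfolding p_def comp_def
    using that bv bw by (intro f_the_inv_into_f_bij_betw[OF bv]) (auto simp: bij_betw_def)
  from \<open>c \<in> _\<close> obtain v where "eigenvector (adjacency_matrix vs G) v c"
    by (auto simp: spectrum_def eigenvalue_def)
  then have v: "v \<in> carrier_vec n" "v \<noteq> 0\<^sub>v n" "adjacency_matrix vs G *\<^sub>v v = c \<cdot>\<^sub>v v"
    by (auto simp: eigenvector_def adjacency_matrix_def n)
  define w where "w = vec n (\<lambda>i. v $ p i)"
  have "adjacency_matrix ws G *\<^sub>v w = c \<cdot>\<^sub>v w"
  proof (rule eq_vecI)
    fix i assume "i < dim_vec (c \<cdot>\<^sub>v w)"
    then have i: "i < n" by (simp add: w_def)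
    have "(adjacency_matrix ws G *\<^sub>v w) $ i =
        (\<Sum>j\<in>{..<n}. (if (ws ! i, ws ! j) \<in> parcs G then 1 else 0) * v $ p j)"
      using i by (simp add: adjacency_matrix_def n w_def scalar_prod_def lessThan_atLeast0)
    also have "\<dots> = (\<Sum>j\<in>{..<n}. (if (vs ! p i, vs ! p j) \<in> parcs G then 1 else 0) * v $ p j)"
      using i by (intro sum.cong) (auto simp: vp)
    also have "\<dots> = (\<Sum>j\<in>{..<n}. (if (vs ! p i, vs ! j) \<in> parcs G then 1 else 0) * v $ j)"
      by (rule sum.reindex_bij_betw[OF p])
    also have "\<dots> = (adjacency_matrix vs G *\<^sub>v v) $ p i"
      using pn[OF i] v(1) by (simp add: adjacency_matrix_def n scalar_prod_def lessThan_atLeast0)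
    also have "\<dots> = (c \<cdot>\<^sub>v w) $ i"
      using i pn[OF i] v by (simp add: w_def)
    finally show "(adjacency_matrix ws G *\<^sub>v w) $ i = (c \<cdot>\<^sub>v w) $ i" .
  qed (simp add: adjacency_matrix_def n w_def)
  moreover have "w \<noteq> 0\<^sub>v n"
  proof
    assume w0: "w = 0\<^sub>v n"
    have "v = 0\<^sub>v n"
    proof (rule eq_vecI)
      fix j assume "j < dim_vec (0\<^sub>v n :: complex vec)"
      then have j: "j < n" by simp
      then obtain i where i: "i < n" "j = p i"
        using p by (auto simp: bij_betw_def set_eq_iff image_iff)
      have "v $ j = w $ i" using i by (simp add: w_def)
      then show "v $ j = 0\<^sub>v n $ j" using w0 i j by simp
    qed (use v in auto)
    with v(2) show False by simp
  qed
  ultimately show "c \<in> spectrum (adjacency_matrix ws G)"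
    by (auto simp: spectrum_def eigenvalue_def eigenvector_def adjacency_matrix_def n w_def
        intro!: exI[of _ w])
qed

lemma rho_eq:
  assumes "distinct vs" "set vs = pverts G"
  shows "rho G = spectral_radius (adjacency_matrix vs G)"
proof -
  let ?ws = "SOME vs. distinct vs \<and> set vs = pverts G"
  have "distinct ?ws \<and> set ?ws = pverts G"
    by (rule someI[of _ vs]) (use assms in simp)
  then have "spectrum (adjacency_matrix ?ws G) = spectrum (adjacency_matrix vs G)"
    using assms by (intro equalityI spectrum_adjacency_matrix_subset) auto
  then show ?thesis by (simp add: rho_def spectral_radius_def)
qed

lemma complete_digraph_complete_graph: "complete_digraph m (with_proj (complete_graph m))"
  by (auto simp: complete_digraph_pair_def complete_graph_def)

lemma pair_graph_iff:
  "pair_graph G \<longleftrightarrow> finite (pverts G) \<and> parcs G \<subseteq> pverts G \<times> pverts G \<and>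
     sym (parcs G) \<and> irrefl (parcs G)" (is "_ \<longleftrightarrow> ?R")
proof
  assume "pair_graph G"
  then interpret pair_graph G .
  show ?R
    using pair_sym_arcs pair_no_loops wellformed' pair_finite_verts
    by (fastforce simp: symmetric_def irrefl_def)
next
  assume R: ?R
  then have "finite (parcs G)" by (auto intro: finite_subset)
  with R show "pair_graph G"
    by unfold_locales (auto simp: symmetric_def irrefl_def)
qed

lemma pair_graph_complete_graph: "pair_graph (complete_graph m)"
  by (auto simp: pair_graph_iff complete_graph_def sym_def irrefl_def)

lemma pair_graph_copies: "pair_graph H \<Longrightarrow> pair_graph (copies m H)"
  by (auto simp: pair_graph_iff copies_def sym_def irrefl_def)

lemma pair_graph_disjoint_union:
  "pair_graph G \<Longrightarrow> pair_graph H \<Longrightarrow> pair_graph (disjoint_union G H)"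
  by (auto simp: pair_graph_iff disjoint_union_def sym_def irrefl_def)

lemma pair_graph_graph_join:
  "pair_graph G \<Longrightarrow> pair_graph H \<Longrightarrow> pair_graph (graph_join G H)"
  by (auto simp: pair_graph_iff graph_join_def disjoint_union_def sym_def irrefl_def)

lemma pair_graph_extremal_graph: "pair_graph (extremal_graph n k)"
  unfolding extremal_graph_def
  by (intro pair_graph_graph_join pair_graph_disjoint_union pair_graph_copies
      pair_graph_complete_graph)

lemma card_pverts_extremal_graph:
  "n \<ge> k + 3 \<Longrightarrow> card (pverts (extremal_graph n k)) = n"
  by (simp add: extremal_graph_def graph_join_def disjoint_union_def copies_def
      complete_graph_def card_Plus card_cartesian_product)

end

theory Submission
  imports Defs "HOL-Library.Disjoint_Sets"
begin

text \<open>
  If some edge \<open>e\<close> lies in no matching of size \<open>(n - k) / 2\<close>, the Tutte--Berge formula for \<open>G - e\<close>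
  (the two end vertices deleted) yields a set \<open>S\<close> with \<open>e \<subseteq> S\<close>, \<open>s = |S| \<ge> 2\<close>, such that \<open>G - S\<close>
  splits into at least \<open>s + k\<close> blocks without edges between them. So \<open>G\<close> is a spanning subgraph of
  the graph \<open>H\<close> in which \<open>S\<close> is joined to everything and all blocks are cliques.
  The weight \<open>x\<close> that is \<open>1 / s\<close> on \<open>S\<close> and \<open>1 / (l + 1 - |C|)\<close> on a block \<open>C\<close> satisfies \<open>A x = l x\<close>
  off \<open>S\<close>, where \<open>A\<close> is the adjacency matrix of \<open>H\<close>, and \<open>A x \<le> l x\<close> on \<open>S\<close> if and only if
  \<open>1 + (\<Sum>C. |C| / (l + 1 - |C|)) \<le> (l + 1) / s\<close>; in that case \<open>\<rho>(G) \<le> l\<close>.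
  By convexity the sum is largest when all blocks but one are singletons.
  For \<open>s = 2\<close> the condition then holds with equality at an eigenvalue of the extremal graph, and
  equality \<open>\<rho>(G) = l\<close> forces \<open>G = H\<close> with all blocks but one singletons. For \<open>s \<ge> 3\<close> it already holds at
  \<open>l = n - k - 2\<close> (at \<open>l = 21 / 5\<close> in the exceptional case \<open>k = 0\<close>, \<open>n = 6\<close>), which is smaller than that
  eigenvalue.
\<close>

section \<open>The Tutte--Berge formula\<close>

text \<open>The edge set stays fixed and only the vertex set shrinks; this replaces induced
  subgraphs, so the induction in \<open>tutte_berge\<close> can delete a vertex without touching
  \<open>E\<close>.\<close>

definition matching_within :: "'a set set \<Rightarrow> 'a set \<Rightarrow> 'a set set \<Rightarrow> bool" where
  "matching_within E V M \<longleftrightarrow> M \<subseteq> E \<and> disjoint M \<and> \<Union>M \<subseteq> V"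

definition maximum_matching :: "'a set set \<Rightarrow> 'a set \<Rightarrow> 'a set set \<Rightarrow> bool" where
  "maximum_matching E V M \<longleftrightarrow>
     matching_within E V M \<and> (\<forall>N. matching_within E V N \<longrightarrow> card N \<le> card M)"

lemma matching_within_finite: "matching_within E V M \<Longrightarrow> finite V \<Longrightarrow> finite M"
  by (metis finite_UnionD finite_subset matching_within_def)

lemma card_Union_matching:
  assumes "matching_within E V M" "\<forall>e\<in>E. card e = 2"
  shows "card (\<Union>M) = 2 * card M"
proof -
  have "card (\<Union>M) = sum card M"
    using assms by (intro card_Union_disjoint)
      (auto simp: matching_within_def disjoint_def pairwise_def disjnt_def card_ge_0_finite subset_iff)
  also have "\<dots> = (\<Sum>e\<in>M. 2)"
    using assms by (intro sum.cong) (auto simp: matching_within_def)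
  finally show ?thesis by simp
qed

lemma card_matching_le:
  assumes "matching_within E V M" "\<forall>e\<in>E. card e = 2" "finite V"
  shows "card M \<le> card V"
proof -
  have "card (\<Union>M) \<le> card V"
    using assms by (auto simp: matching_within_def intro: card_mono)
  then show ?thesis using card_Union_matching[OF assms(1,2)] by simp
qed

lemma maximum_matching_exists:
  assumes "\<forall>e\<in>E. card e = 2" "finite V"
  shows "\<exists>M. maximum_matching E V M"
proof -
  have "matching_within E V {}" by (simp add: matching_within_def disjoint_def)
  then have "\<exists>M. matching_within E V M \<and> (\<forall>N. matching_within E V N \<longrightarrow> card N \<le> card M)"
    by (rule ex_has_greatest_nat[where b = "Suc (card V)"])
      (auto dest: card_matching_le[OF _ assms] simp: le_imp_less_Suc)
  then show ?thesis by (simp add: maximum_matching_def)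
qed

text \<open>Otherwise \<open>e\<close> could be added to \<open>M\<close>. Hence no maximum matching
  misses both ends of an edge, which puts adjacent vertices into one class in
  \<open>tutte_berge\<close>.\<close>

lemma maximum_matching_edge_meets:
  assumes M: "maximum_matching E V M" and "finite V" and e: "e \<in> E" "e \<subseteq> V" "e \<noteq> {}"
  shows "e \<inter> \<Union>M \<noteq> {}"
proof
  assume d: "e \<inter> \<Union>M = {}"
  then have "e \<notin> M" using e(3) by blast
  have "disjnt e f" if "f \<in> M" for f using d that by (auto simp: disjnt_def)
  then have "matching_within E V (insert e M)"
    using M e by (auto simp: maximum_matching_def matching_within_def pairwise_insert disjnt_sym)
  then have "card (insert e M) \<le> card M" using M by (simp add: maximum_matching_def)
  then show False
    using \<open>e \<notin> M\<close> M matching_within_finite[OF _ assms(2)] by (auto simp: maximum_matching_def)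
qed

text \<open>
  Gallai's lemma: starting from a maximum matching \<open>N\<close> missing \<open>t\<close> that shares as many edges with
  \<open>M\<close> as possible, exchanging an edge of \<open>N\<close> for an edge of \<open>M\<close> increases the overlap.
\<close>

lemma maximum_matchings_miss_trans:
  assumes E: "\<forall>e\<in>E. card e = 2" and V: "finite V"
    and M: "maximum_matching E V M" "u \<notin> \<Union>M" "v \<notin> \<Union>M" "u \<noteq> v"
    and t: "\<And>N. maximum_matching E V N \<Longrightarrow> t \<notin> \<Union>N \<Longrightarrow> u \<in> \<Union>N \<and> v \<in> \<Union>N"
    and ex: "\<exists>N. maximum_matching E V N \<and> t \<notin> \<Union>N"
  shows False
proof -
  let ?P = "\<lambda>N. maximum_matching E V N \<and> t \<notin> \<Union>N"
  have finM: "finite M" and MM: "matching_within E V M"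
    using M V by (auto simp: maximum_matching_def matching_within_finite)
  obtain N0 where "?P N0" using ex by blast
  then have "\<exists>N. ?P N \<and> (\<forall>N'. ?P N' \<longrightarrow> card (M \<inter> N') \<le> card (M \<inter> N))"
    by (rule ex_has_greatest_nat[where b = "Suc (card M)"])
      (auto simp: le_imp_less_Suc finM card_mono)
  then obtain N where N: "maximum_matching E V N" "t \<notin> \<Union>N"
    and max: "\<And>N'. ?P N' \<Longrightarrow> card (M \<inter> N') \<le> card (M \<inter> N)" by blast
  have NN: "matching_within E V N" and finN: "finite N"
    using N V by (auto simp: maximum_matching_def matching_within_finite)
  have cMN: "card M = card N"
    using M(1) N(1) by (auto simp: maximum_matching_def intro: antisym)
  have fin: "finite (\<Union>M)" "finite (\<Union>N)"
    using MM NN V by (auto simp: matching_within_def intro: finite_subset)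
  \<comment> \<open>Both matchings cover equally many vertices, and \<open>N\<close> covers
    \<open>u\<close> and \<open>v\<close>, which \<open>M\<close> misses. So \<open>M\<close> covers
    at least two vertices missed by \<open>N\<close>, and one of them is not
    \<open>t\<close>.\<close>
  have "card (\<Union>M - \<Union>N) = card (\<Union>N - \<Union>M)"
    using card_Union_matching[OF MM E] card_Union_matching[OF NN E] cMN fin
    by (metis card_le_sym_Diff le_antisym order_refl)
  moreover have "{u, v} \<subseteq> \<Union>N - \<Union>M" using t[OF N] M by auto
  then have "card {u, v} \<le> card (\<Union>N - \<Union>M)" using fin by (intro card_mono) auto
  ultimately have "\<not> \<Union>M - \<Union>N \<subseteq> {t}"
    using M(4) card_mono[of "{t}" "\<Union>M - \<Union>N"] by auto
  then obtain x where x: "x \<in> \<Union>M" "x \<notin> \<Union>N" "x \<noteq> t" by blast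
  then obtain e where e: "e \<in> M" "x \<in> e" by blast
  have eE: "e \<in> E" "e \<subseteq> V" using e MM by (auto simp: matching_within_def)
  then have "card e = 2" using E by blast
  then obtain y where y: "e = {x, y}" "x \<noteq> y"
    using e(2) by (auto simp: card_2_iff)
  have "y \<in> \<Union>N"
    using maximum_matching_edge_meets[OF N(1) V eE] y x by auto
  then obtain f where f: "f \<in> N" "y \<in> f" by blast
  have "f \<notin> M"
  proof
    assume "f \<in> M"
    moreover have "y \<in> e" using y by simp
    ultimately have "f = e"
      using e f MM unfolding matching_within_def pairwise_def disjnt_def by blast
    then show False using f x e by auto
  qed
  have eN: "e \<notin> N" using x e by auto
  let ?N' = "insert e (N - {f})"
  have dN: "g \<inter> e = {}" if "g \<in> N - {f}" for g
  proof -
    have "g \<inter> f = {}" using that f NN by (auto simp: matching_within_def pairwise_def disjnt_def)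
    then show ?thesis using that x y f by auto
  qed
  have "disjoint (N - {f})" using NN by (auto simp: matching_within_def intro: pairwise_subset)
  then have "disjoint ?N'"
    unfolding pairwise_insert disjnt_def using dN by (metis Int_commute)
  then have "matching_within E V ?N'" using NN eE by (auto simp: matching_within_def)
  moreover have "card ?N' = card N" 
    using eN f finN card_Suc_Diff1[OF finN f(1)] by simp
  ultimately have "maximum_matching E V ?N'" using N(1) by (simp add: maximum_matching_def)
  \<comment> \<open>The new edge consists of \<open>x\<close>, chosen different from
    \<open>t\<close>, and \<open>y\<close>, which \<open>N\<close> covers while it misses
    \<open>t\<close>.\<close>
  moreover have "t \<notin> \<Union>?N'" using N(2) x y \<open>y \<in> \<Union>N\<close> by auto
  ultimately have "card (M \<inter> ?N') \<le> card (M \<inter> N)" using max by blast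
  moreover have "M \<inter> ?N' = insert e (M \<inter> N)" using e \<open>f \<notin> M\<close> by auto
  ultimately show False using eN finM by simp
qed

text \<open>The nontrivial half of the Tutte--Berge formula, with the blocks of a partition instead of
  odd components.\<close>

lemma tutte_berge:
  fixes E :: "'a set set"
  assumes "finite V" "\<forall>e\<in>E. card e = 2" "\<And>M. matching_within E V M \<Longrightarrow> card M \<le> r"
  shows "\<exists>T P. T \<subseteq> V \<and> partition_on (V - T) P \<and>
    (\<forall>e\<in>E. e \<subseteq> V - T \<longrightarrow> (\<exists>C\<in>P. e \<subseteq> C)) \<and> card T + card V \<le> card P + 2 * r"
  using assms(1,3)
proof (induction "card V" arbitrary: V r rule: less_induct)
  case less
  note E = assms(2)
  obtain M0 where M0: "maximum_matching E V M0" using maximum_matching_exists[OF E less(2)] by blast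
  then have M0r: "card M0 \<le> r" using less(3) by (simp add: maximum_matching_def)
  show ?case
  \<comment> \<open>A vertex covered by every maximum matching goes into \<open>T\<close> and is
    deleted; if there is none, \<open>T\<close> is empty and the blocks are the classes of an
    equivalence relation.\<close>
  proof (cases "\<exists>v\<in>V. \<forall>M. maximum_matching E V M \<longrightarrow> v \<in> \<Union>M")
    case True
    then obtain v where v: "v \<in> V" "\<And>M. maximum_matching E V M \<Longrightarrow> v \<in> \<Union>M" by blast
    \<comment> \<open>Deleting \<open>v\<close> lowers the matching number: a matching of this size
      without \<open>v\<close> would be a maximum matching missing \<open>v\<close>.\<close>
    have "card N < card M0" if N: "matching_within E (V - {v}) N" for N
    proof (rule ccontr)
      assume "\<not> card N < card M0"
      moreover have "matching_within E V N" using N by (auto simp: matching_within_def)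
      ultimately have "maximum_matching E V N" using M0 by (fastforce simp: maximum_matching_def)
      then show False using v N by (auto simp: matching_within_def)
    qed
    then have le: "card N \<le> card M0 - 1" if "matching_within E (V - {v}) N" for N
      using that by fastforce
    have "M0 \<noteq> {}" using v(2)[OF M0] by auto
    then have pos: "card M0 > 0"
      using matching_within_finite less(2) M0 by (auto simp: maximum_matching_def card_gt_0_iff)
    have "card (V - {v}) < card V" using v less(2) by (intro card_Diff1_less)
    then obtain T P where TP: "T \<subseteq> V - {v}" "partition_on (V - {v} - T) P"
      "\<forall>e\<in>E. e \<subseteq> V - {v} - T \<longrightarrow> (\<exists>C\<in>P. e \<subseteq> C)"
      "card T + card (V - {v}) \<le> card P + 2 * (card M0 - 1)"
      using less(1)[of "V - {v}" "card M0 - 1"] less(2) le by auto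
    have eq: "V - {v} - T = V - insert v T" by auto
    have "finite T" "v \<notin> T" using TP(1) less(2) by (auto intro: finite_subset)
    \<comment> \<open>Restoring \<open>v\<close> adds one to \<open>card T\<close> and one to
      \<open>card V\<close>; the drop of the matching number by one pays for both.\<close>
    then have "card (insert v T) + card V \<le> card P + 2 * r"
      using TP(4) pos M0r v(1) less(2) by (simp add: card_Diff_singleton)
    then show ?thesis
      using TP v(1) unfolding eq by (intro exI[of _ "insert v T"] exI[of _ P]) auto
  next
    case False
    \<comment> \<open>Distinct vertices are related if no maximum matching misses both. In this case
      each vertex is missed by some maximum matching, as the exchange lemma behind transitivity
      requires.\<close>
    define R where "R = {(u, v). u \<in> V \<and> v \<in> V \<and>
      (u = v \<or> (\<forall>M. maximum_matching E V M \<longrightarrow> u \<in> \<Union>M \<or> v \<in> \<Union>M))}"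
    have R: "equiv V R"
    proof (rule equivI)
      show "R \<subseteq> V \<times> V" by (auto simp: R_def)
      show "refl_on V R" by (auto simp: R_def refl_on_def)
      show "sym R" by (auto simp: R_def sym_def)
      show "trans R"
      proof (rule transI)
        fix u t v assume ut: "(u, t) \<in> R" and tv: "(t, v) \<in> R"
        show "(u, v) \<in> R"
        proof (rule ccontr)
          assume nR: "(u, v) \<notin> R"
          have V: "u \<in> V" "t \<in> V" "v \<in> V" using ut tv by (auto simp: R_def)
          with nR obtain M where M: "maximum_matching E V M" "u \<notin> \<Union>M" "v \<notin> \<Union>M" "u \<noteq> v"
            by (auto simp: R_def)
          have "u \<noteq> t" "v \<noteq> t" using ut tv nR by auto
          then have "u \<in> \<Union>N \<and> v \<in> \<Union>N" if "maximum_matching E V N" "t \<notin> \<Union>N" for N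
            using ut tv that unfolding R_def by blast
          moreover have "\<exists>N. maximum_matching E V N \<and> t \<notin> \<Union>N" using False V by blast
          ultimately show False
            using maximum_matchings_miss_trans[OF E less(2) M, of t] by blast
        qed
      qed
    qed
    have "\<exists>C\<in>V // R. e \<subseteq> C" if e: "e \<in> E" "e \<subseteq> V" for e
    proof -
      obtain u v where uv: "e = {u, v}" using E e by (metis card_2_iff)
      have "(u, v) \<in> R"
        using maximum_matching_edge_meets[OF _ less(2) e] e(2) uv by (fastforce simp: R_def)
      then have "e \<subseteq> R `` {u}" using R uv e(2) by (auto simp: equiv_def refl_on_def)
      then show ?thesis using e(2) uv by (intro bexI[of _ "R `` {u}"] quotientI) auto
    qed
    moreover have "card V \<le> card (V // R) + 2 * r"
    proof -
      have MM: "matching_within E V M0" using M0 by (simp add: maximum_matching_def)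
      have sub: "\<Union>M0 \<subseteq> V" using MM by (simp add: matching_within_def)
      \<comment> \<open>Distinct vertices missed by \<open>M0\<close> are unrelated, so each of the
        \<open>card V - 2 * card M0\<close> missed vertices has a class of its own.\<close>
      have "inj_on (\<lambda>u. R `` {u}) (V - \<Union>M0)"
      proof (rule inj_onI)
        fix u v assume uv: "u \<in> V - \<Union>M0" "v \<in> V - \<Union>M0" "R `` {u} = R `` {v}"
        then have "(u, v) \<in> R" using R by (simp add: eq_equiv_class_iff)
        then show "u = v" using uv M0 by (auto simp: R_def)
      qed
      moreover have "(\<lambda>u. R `` {u}) ` (V - \<Union>M0) \<subseteq> V // R" by (auto intro: quotientI)
      moreover have "finite (V // R)" using R less(2) by (simp add: equiv_def finite_quotient)
      ultimately have "card (V - \<Union>M0) \<le> card (V // R)" by (rule card_inj_on_le)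
      moreover have "card (V - \<Union>M0) = card V - 2 * card M0"
        using card_Diff_subset[OF finite_subset[OF sub less(2)] sub]
          card_Union_matching[OF MM E] by simp
      ultimately show ?thesis using M0r by linarith
    qed
    ultimately show ?thesis
      using partition_on_quotient[OF R]
      by (intro exI[of _ "{}"] exI[of _ "V // R"]) auto
  qed
qed

section \<open>Real inequalities\<close>

text \<open>The function t / (l + 1 - t) is convex for t < l + 1, so with fixed total and all values
  at least 1 the sum grows when mass moves to the largest value. The second disjunct keeps the
  equality case for the uniqueness claim.\<close>

lemma block_sum_bound:
  fixes f :: "'b \<Rightarrow> real" and l r :: real
  assumes "finite P" "\<And>C. C \<in> P \<Longrightarrow> 1 \<le> f C" "r + 1 \<le> card P" "0 \<le> r" "sum f P - r \<le> l"
  shows "(\<Sum>C\<in>P. f C / (l + 1 - f C)) < r / l + (sum f P - r) / (l + 1 - (sum f P - r))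
    \<or> (\<Sum>C\<in>P. f C / (l + 1 - f C)) = r / l + (sum f P - r) / (l + 1 - (sum f P - r))
      \<and> (\<exists>C\<in>P. f C = sum f P - r)"
proof -
  define M where "M = sum f P"
  have "P \<noteq> {}" using assms(3,4) by auto
  then obtain C0 where C0: "C0 \<in> P" "\<And>C. C \<in> P \<Longrightarrow> f C \<le> f C0"
    using Max_in[of "f ` P"] Max_ge[of "f ` P"] assms(1) by (metis (no_types, lifting) finite_imageI image_iff image_is_empty)
  define N where "N = f C0"
  define Q where "Q = real (card (P - {C0}))"
  define c where "c = l + 1 - N"
  define d where "d = (l + 1) / (l * c)"
  have Q: "r \<le> Q" 
    using assms(1,3) C0(1) by (simp add: Q_def card_Diff_singleton)
  have rest: "(\<Sum>C\<in>P - {C0}. f C) = M - N"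
    using assms(1) C0 by (simp add: sum_diff1 M_def N_def)
  have "(\<Sum>C\<in>P - {C0}. 1) \<le> (\<Sum>C\<in>P - {C0}. f C)" using assms(2) by (intro sum_mono) auto
  then have QM: "Q \<le> M - N" by (simp add: rest Q_def)
  have N: "1 \<le> N" "N \<le> M - r" "M - r \<le> l" using assms(2,5) C0 Q QM by (auto simp: N_def M_def)
  then have c: "1 \<le> c" "c \<le> l" by (auto simp: c_def)
  \<comment> \<open>The right side is the chord of the convex function through t = 1 and t =
    \<open>N\<close>; \<open>d\<close> is its slope.\<close>
  have chord: "t / (l + 1 - t) \<le> 1 / l + (t - 1) * d" if t: "1 \<le> t" "t \<le> N" for t
  proof -
    have pos: "0 < l + 1 - t" "0 < l" "0 < c" using t c N by (auto simp: c_def)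
    have "1 / l + (t - 1) * d - t / (l + 1 - t)
        = (t - 1) * (l + 1) * (N - t) / (l * c * (l + 1 - t))"
      using pos by (simp add: d_def divide_simps) (simp add: c_def algebra_simps)
    also have "\<dots> \<ge> 0" using pos t by (intro divide_nonneg_pos mult_nonneg_nonneg) auto
    finally show ?thesis by simp
  qed
  have "(\<Sum>C\<in>P. f C / (l + 1 - f C)) = N / c + (\<Sum>C\<in>P - {C0}. f C / (l + 1 - f C))"
    using assms(1) C0 by (simp add: sum.remove N_def c_def)
  also have "(\<Sum>C\<in>P - {C0}. f C / (l + 1 - f C)) \<le>
      (\<Sum>C\<in>P - {C0}. 1 / l + (f C - 1) * d)"
    using assms(2) C0(2) by (intro sum_mono chord) (auto simp: N_def)
  also have "\<dots> = Q * (1 / l) + (M - N - Q) * d"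
    by (simp add: sum.distrib sum_distrib_right[symmetric] sum_subtractf rest Q_def)
  \<comment> \<open>Only \<open>r\<close> values are kept at 1: the surplus values are traded for
    mass at slope \<open>d\<close>, which is at least \<open>1 / l\<close>.\<close>
  also have "\<dots> \<le> r * (1 / l) + (M - N - r) * d"
  proof -
    have "1 / l \<le> d" using c by (simp add: d_def divide_simps)
    then have "(Q - r) * (1 / l) \<le> (Q - r) * d" using Q by (intro mult_left_mono) auto
    then show ?thesis unfolding left_diff_distrib by simp
  qed
  finally have le: "(\<Sum>C\<in>P. f C / (l + 1 - f C)) \<le> N / c + r / l + (M - N - r) * d"
    by simp
  \<comment> \<open>\<open>T\<close> is the mass still to be moved onto the largest value. Beyond
    \<open>N\<close> the function lies above the prolonged chord, strictly so unless
    \<open>T = 0\<close>, that is, \<open>N = M - r\<close>.\<close>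
  define T where "T = M - N - r"
  have T: "0 \<le> T" "1 \<le> c - T" using N by (auto simp: T_def c_def)
  have step: "(M - r) / (l + 1 - (M - r)) - (N / c + T * d)
      = T * (l + 1) * (l - (c - T)) / (l * c * (c - T))"
  proof -
    have *: "M - r = N + T" "l + 1 - (M - r) = c - T" and l: "l = c + N - 1"
      by (auto simp: T_def c_def)
    have "0 < c - T" "0 < l" "0 < c" using T c by auto
    then show ?thesis unfolding *
      by (simp add: d_def divide_simps) (simp add: l algebra_simps)
  qed
  show ?thesis
  proof (cases "T = 0")
    case True
    then have "f C0 = M - r" "(\<Sum>C\<in>P. f C / (l + 1 - f C)) \<le> r / l + (M - r) / (l + 1 - (M - r))"
      using le step by (auto simp: T_def N_def)
    then show ?thesis using C0(1) unfolding M_def by fastforce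
  next
    case False
    then have "T * (l + 1) * (l - (c - T)) / (l * c * (c - T)) > 0"
      using T c by (intro divide_pos_pos mult_pos_pos) auto
    then show ?thesis using le step unfolding M_def T_def by linarith
  qed
qed

text \<open>This is the condition of \<open>rho_le_separator_bound\<close> at l = \<open>m\<close> =
  n - k - 2, where q = m - 2s + 3 and l + 1 - q = 2s - 2. Clearing denominators leaves a polynomial
  inequality. The last hypothesis remembers that \<open>s\<close> is an integer.\<close>

lemma large_separator_bound:
  fixes m s k :: real
  assumes "3 \<le> s" "2 * s \<le> m + 2" "4 * k + 4 \<le> m" "6 \<le> m" "s = 3 \<or> 4 \<le> s"
  shows "1 + ((s + k - 1) / m + (m - 2 * s + 3) / (2 * s - 2)) \<le> (m + 1) / s"
proof -
  have "2 * s * (s - 1) * (s + k - 1) \<le> m * (m + 1) * (s - 2)"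
    using assms(5)
  proof
    assume s: "s = 3"
    have "0 \<le> (m - 6) * (m + 4)" using assms by simp
    then show ?thesis using assms(3) unfolding s by (simp add: algebra_simps)
  next
    assume s: "4 \<le> s"
    \<comment> \<open>The bound on \<open>k\<close> gives k <= m / 4 - 1, which eliminates
      \<open>k\<close>.\<close>
    have "2 * s * (s - 1) * (s + k - 1) \<le> 2 * s * (s - 1) * (s - 2 + m / 4)"
      using assms by (intro mult_left_mono) auto
    also have "\<dots> = (2 * (s - 1)) * (s * (s - 2)) + m * (s * (s - 1) / 2)" by (simp add: field_simps)
    also have "\<dots> \<le> m * (s * (s - 2)) + m * (s * (s - 1) / 2)"
      using s assms by (intro add_right_mono mult_right_mono) auto
    also have "\<dots> = m * (s * (s - 2) + s * (s - 1) / 2)" by (simp add: algebra_simps)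
    also have "\<dots> \<le> m * ((m + 1) * (s - 2))"
    proof (intro mult_left_mono)
      have "0 \<le> (s - 1) * (s / 2 - 2) + (m + 2 - 2 * s) * (s - 2)"
        using s assms by (intro add_nonneg_nonneg mult_nonneg_nonneg) auto
      also have "\<dots> = (m + 1) * (s - 2) - (s * (s - 2) + s * (s - 1) / 2)"
        by (simp add: algebra_simps)
      finally show "s * (s - 2) + s * (s - 1) / 2 \<le> (m + 1) * (s - 2)" by simp
    qed (use assms in auto)
    finally show ?thesis by (simp add: algebra_simps)
  qed
  moreover have "(m + 1) / s - (1 + ((s + k - 1) / m + (m - 2 * s + 3) / (2 * s - 2)))
      = (m * (m + 1) * (s - 2) - 2 * s * (s - 1) * (s + k - 1)) / (s * m * (2 * s - 2))"
    using assms by (simp add: divide_simps) (simp add: algebra_simps)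
  moreover have "0 < s * m * (2 * s - 2)" using assms by auto
  ultimately show ?thesis by (smt (verit) divide_nonneg_pos)
qed

text \<open>The equation is the eigenvalue equation of the three-class quotient of the extremal
  graph, whose clique has \<open>m - 1\<close> vertices. Its left side is larger at \<open>a\<close>
  and at most the right side at \<open>m + 1\<close>. Leaving \<open>a\<close> free covers the
  exceptional small case.\<close>

lemma quotient_root_exists:
  fixes m k a :: real
  assumes "0 \<le> k" "4 * k + 4 \<le> m" "m \<le> a" "a \<le> m + 1"
    and a: "(a + 1) / 2 < 1 + ((k + 1) / a + (m - 1) / (a + 1 - (m - 1)))"
  shows "\<exists>l>a. 1 + ((k + 1) / l + (m - 1) / (l + 1 - (m - 1))) = (l + 1) / 2"
proof -
  define g where "g l = (l + 1) / 2 - (1 + ((k + 1) / l + (m - 1) / (l + 1 - (m - 1))))" for l :: real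
  have "continuous_on {a..m + 1} g"
    unfolding g_def using assms by (intro continuous_intros) auto
  moreover have "g a \<le> 0" using a by (simp add: g_def)
  moreover have "g (m + 1) \<ge> 0"
  proof -
    have "g (m + 1) = (m + 2) / 6 - (k + 1) / (m + 1)" by (simp add: g_def field_simps)
    moreover have "(k + 1) / (m + 1) \<le> 1 / 4" using assms by (simp add: field_simps)
    moreover have "(m + 2) / 6 \<ge> 1" using assms by simp
    ultimately show ?thesis by linarith
  qed
  ultimately obtain l where l: "a \<le> l" "l \<le> m + 1" "g l = 0"
    using IVT'[of g a 0 "m + 1"] assms by auto
  moreover have "l \<noteq> a" using l a by (auto simp: g_def)
  ultimately show ?thesis by (intro exI[of _ l]) (auto simp: g_def)
qed

section \<open>Spectral radius and adjacency sums\<close>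

text \<open>Entry \<open>v\<close> of the adjacency matrix times \<open>f\<close>. Indexing by
  vertices keeps the enumeration inside \<open>rho\<close> out of the later arguments.\<close>

definition adj_sum :: "'a pair_pre_digraph \<Rightarrow> ('a \<Rightarrow> real) \<Rightarrow> 'a \<Rightarrow> real" where
  "adj_sum G f v = (\<Sum>w\<in>pverts G. of_bool ((v, w) \<in> parcs G) * f w)"

lemma adjacency_matrix_mult_vec:
  assumes "distinct vs" "set vs = pverts G" "z \<in> carrier_vec (length vs)" "i < length vs"
    and "\<And>j. j < length vs \<Longrightarrow> f (vs ! j) = z $ j"
  shows "(adjacency_matrix vs G *\<^sub>v z) $ i
    = (\<Sum>w\<in>pverts G. of_bool ((vs ! i, w) \<in> parcs G) * f w)"
proof -
  have "(adjacency_matrix vs G *\<^sub>v z) $ i =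
      (\<Sum>j\<in>{..<length vs}. of_bool ((vs ! i, vs ! j) \<in> parcs G) * z $ j)"
    using assms(3,4)
    by (simp add: adjacency_matrix_def scalar_prod_def lessThan_atLeast0 of_bool_def)
  also have "\<dots> = (\<Sum>j\<in>{..<length vs}. of_bool ((vs ! i, vs ! j) \<in> parcs G) * f (vs ! j))"
    using assms(5) by (intro sum.cong) auto
  also have "\<dots> = (\<Sum>w\<in>pverts G. of_bool ((vs ! i, w) \<in> parcs G) * f w)"
    using assms(1,2)
    by (intro sum.reindex_bij_betw[where g = "\<lambda>w. of_bool ((vs ! i, w) \<in> parcs G) * f w"] bij_betw_nth) auto
  finally show ?thesis .
qed

lemma adjacency_matrix_carrier: "adjacency_matrix vs G \<in> carrier_mat (length vs) (length vs)"
  by (simp add: adjacency_matrix_def)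

text \<open>Take moduli in a complex eigenvector whose eigenvalue has maximal modulus: the triangle
  inequality turns the eigenvalue equation into this inequality.\<close>

lemma rho_subeigenvector:
  assumes "finite (pverts G)" "pverts G \<noteq> {}"
  obtains y where "\<And>v. 0 \<le> y v" "\<exists>v\<in>pverts G. 0 < y v"
    "\<And>v. v \<in> pverts G \<Longrightarrow> rho G * y v \<le> adj_sum G y v"
proof -
  obtain vs where vs: "distinct vs" "set vs = pverts G"
    using finite_distinct_list[OF assms(1)] by blast
  define n where "n = length vs"
  let ?A = "adjacency_matrix vs G"
  have A: "?A \<in> carrier_mat n n" by (simp add: n_def adjacency_matrix_carrier)
  have n: "n > 0" using assms(2) vs by (auto simp: n_def)
  obtain a where a: "a \<in> spectrum ?A" "norm a = rho G"
    using spectral_radius_mem_max(1)[OF A n] rho_eq[OF vs] by auto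
  then obtain z where z: "z \<in> carrier_vec n" "z \<noteq> 0\<^sub>v n" "?A *\<^sub>v z = a \<cdot>\<^sub>v z"
    using A by (auto simp: spectrum_def eigenvalue_def eigenvector_def)
  have bij: "bij_betw ((!) vs) {..<n} (pverts G)"
    using vs by (auto simp: n_def intro!: bij_betw_nth)
  define f where "f v = z $ the_inv_into {..<n} ((!) vs) v" for v
  have f: "f (vs ! j) = z $ j" if "j < n" for j
    using bij that by (simp add: f_def bij_betw_def the_inv_into_f_f)
  show ?thesis
  proof (rule that[of "\<lambda>v. norm (f v)"])
    show "\<exists>v\<in>pverts G. 0 < norm (f v)"
    proof -
      obtain j where j: "j < n" "z $ j \<noteq> 0"
        using z(1,2) by (metis carrier_vecD eq_vecI index_zero_vec(1) index_zero_vec(2))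
      then show ?thesis using f vs by (intro bexI[of _ "vs ! j"]) (auto simp: n_def)
    qed
    show "rho G * norm (f v) \<le> adj_sum G (\<lambda>v. norm (f v)) v" if v: "v \<in> pverts G" for v
    proof -
      obtain i where i: "i < n" "v = vs ! i" using v vs by (metis in_set_conv_nth n_def)
      have "rho G * norm (f v) = norm ((?A *\<^sub>v z) $ i)"
      proof -
        have "(?A *\<^sub>v z) $ i = a * z $ i" unfolding z(3) using carrier_vecD[OF z(1)] i(1) by simp
        then have "(?A *\<^sub>v z) $ i = a * f v" unfolding i(2) f[OF i(1)] .
        then show ?thesis by (simp add: norm_mult a(2))
      qed
      also have "(?A *\<^sub>v z) $ i = (\<Sum>w\<in>pverts G. of_bool ((v, w) \<in> parcs G) * f w)"
        using adjacency_matrix_mult_vec[OF vs, of z i f] z(1) i f unfolding n_def by blast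
      also have "norm \<dots> \<le> adj_sum G (\<lambda>v. norm (f v)) v"
        unfolding adj_sum_def by (rule sum_norm_le) (simp add: of_bool_def)
      finally show ?thesis .
    qed
  qed auto
qed

lemma eigenvalue_le_rho:
  assumes "finite (pverts G)" "v0 \<in> pverts G" "x v0 \<noteq> 0"
    and eig: "\<And>v. v \<in> pverts G \<Longrightarrow> adj_sum G x v = l * x v"
  shows "\<bar>l\<bar> \<le> rho G"
proof -
  obtain vs where vs: "distinct vs" "set vs = pverts G"
    using finite_distinct_list[OF assms(1)] by blast
  define n where "n = length vs"
  let ?A = "adjacency_matrix vs G"
  have A: "?A \<in> carrier_mat n n" by (simp add: n_def adjacency_matrix_carrier)
  have n: "n > 0" using assms(2) vs by (auto simp: n_def)
  define z :: "complex vec" where "z = vec n (\<lambda>i. of_real (x (vs ! i)))"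
  have "z \<noteq> 0\<^sub>v n"
  proof
    assume z0: "z = 0\<^sub>v n"
    obtain i where i: "i < n" "v0 = vs ! i" using assms(2) vs by (metis in_set_conv_nth n_def)
    have "z $ i = 0\<^sub>v n $ i" using z0 by simp
    then show False using i assms(3) by (simp add: z_def)
  qed
  moreover have "?A *\<^sub>v z = of_real l \<cdot>\<^sub>v z"
  proof (rule eq_vecI)
    fix i assume "i < dim_vec (complex_of_real l \<cdot>\<^sub>v z)"
    then have i: "i < n" by (simp add: z_def)
    have "(?A *\<^sub>v z) $ i = (\<Sum>w\<in>pverts G. of_bool ((vs ! i, w) \<in> parcs G) * complex_of_real (x w))"
      using vs i by (intro adjacency_matrix_mult_vec) (auto simp: n_def z_def)
    also have "\<dots> = of_real (adj_sum G x (vs ! i))"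
      by (auto simp: adj_sum_def of_bool_def intro!: sum.cong)
    also have "\<dots> = (of_real l \<cdot>\<^sub>v z) $ i"
      using i vs eig[of "vs ! i"] nth_mem[of i vs] by (simp add: z_def n_def)
    finally show "(?A *\<^sub>v z) $ i = (of_real l \<cdot>\<^sub>v z) $ i" .
  qed (use A in \<open>auto simp: z_def\<close>)
  ultimately have "complex_of_real l \<in> spectrum ?A"
    using A by (auto simp: spectrum_def eigenvalue_def eigenvector_def intro!: exI[of _ z]) (simp add: z_def)
  then have "norm (complex_of_real l) \<in> norm ` spectrum ?A" by (rule imageI)
  from spectral_radius_mem_max(2)[OF A n this] show ?thesis by (simp add: rho_eq[OF vs])
qed

lemma adj_sum_mono:
  assumes "pverts G = pverts H" "parcs G \<subseteq> parcs H" "\<And>v. 0 \<le> y v"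
  shows "adj_sum G y v \<le> adj_sum H y v"
proof -
  have "of_bool ((v, w) \<in> parcs G) \<le> (of_bool ((v, w) \<in> parcs H) :: real)" for w
    using assms(2) by (auto simp: of_bool_def)
  then show ?thesis
    unfolding adj_sum_def assms(1) using assms(3) by (blast intro: sum_mono mult_right_mono)
qed

lemma adj_sum_symmetric:
  assumes "sym (parcs H)"
  shows "(\<Sum>v\<in>pverts H. x v * adj_sum H y v) = (\<Sum>v\<in>pverts H. adj_sum H x v * y v)"
proof -
  have "(\<Sum>v\<in>pverts H. x v * adj_sum H y v)
      = (\<Sum>v\<in>pverts H. \<Sum>w\<in>pverts H. x v * of_bool ((v, w) \<in> parcs H) * y w)"
    by (simp add: adj_sum_def sum_distrib_left mult_ac)
  also have "\<dots> = (\<Sum>w\<in>pverts H. \<Sum>v\<in>pverts H. x v * of_bool ((v, w) \<in> parcs H) * y w)"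
    by (rule sum.swap)
  also have "\<dots> = (\<Sum>w\<in>pverts H. adj_sum H x w * y w)"
    unfolding adj_sum_def sum_distrib_right
    using assms by (intro sum.cong) (auto simp: sym_def mult_ac intro!: sum.cong)
  finally show ?thesis .
qed

text \<open>Pairing \<open>x\<close> with \<open>y\<close> and using symmetry writes
  \<open>m - l\<close>, times a positive factor, as a sum of three nonnegative defects: of
  \<open>y\<close> in \<open>G\<close>, of the arcs missing from \<open>G\<close>, and of
  \<open>x\<close> in \<open>H\<close>. If \<open>l = m\<close>, each defect vanishes vertex by
  vertex.\<close>

lemma subgraph_eigen_compare:
  assumes "finite (pverts H)" "pverts G = pverts H" "parcs G \<subseteq> parcs H" "sym (parcs H)"
    and x: "\<And>v. v \<in> pverts H \<Longrightarrow> 0 < x v" "\<And>v. v \<in> pverts H \<Longrightarrow> adj_sum H x v \<le> m * x v"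
    and y: "\<And>v. 0 \<le> y v" "\<And>v. v \<in> pverts H \<Longrightarrow> l * y v \<le> adj_sum G y v"
    and v0: "v0 \<in> pverts H" "0 < y v0"
  shows "l \<le> m"
    and "\<And>v. l = m \<Longrightarrow> v \<in> pverts H \<Longrightarrow> adj_sum G y v = l * y v"
    and "\<And>v. l = m \<Longrightarrow> v \<in> pverts H \<Longrightarrow> adj_sum H y v = l * y v"
    and "\<And>v. l = m \<Longrightarrow> v \<in> pverts H \<Longrightarrow> 0 < y v \<Longrightarrow> adj_sum H x v = l * x v"
proof -
  let ?V = "pverts H"
  define D where "D = (\<Sum>v\<in>?V. x v * (adj_sum G y v - l * y v))"
  define D' where "D' = (\<Sum>v\<in>?V. x v * (adj_sum H y v - adj_sum G y v))"
  define D'' where "D'' = (\<Sum>v\<in>?V. (m * x v - adj_sum H x v) * y v)"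
  define K where "K = (\<Sum>v\<in>?V. x v * y v)"
  have mono: "adj_sum G y v \<le> adj_sum H y v" for v
    using adj_sum_mono[OF assms(2,3)] y(1) by blast
  have nn: "0 \<le> x v * (adj_sum G y v - l * y v)" "0 \<le> x v * (adj_sum H y v - adj_sum G y v)"
    "0 \<le> (m * x v - adj_sum H x v) * y v" if "v \<in> ?V" for v
    using that x(1)[OF that] x(2)[OF that] y(1)[of v] y(2)[OF that] mono[of v]
    by (auto intro!: mult_nonneg_nonneg)
  then have D: "0 \<le> D" "0 \<le> D'" "0 \<le> D''" by (auto simp: D_def D'_def D''_def intro!: sum_nonneg)
  have "D + D' + D'' = (\<Sum>v\<in>?V. x v * adj_sum H y v) - (\<Sum>v\<in>?V. adj_sum H x v * y v) + (m - l) * K"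
    by (simp add: D_def D'_def D''_def K_def algebra_simps sum.distrib sum_subtractf sum_distrib_left)
  then have sum: "D + D' + D'' = (m - l) * K" using adj_sum_symmetric[OF assms(4)] by simp
  have "x v0 * y v0 \<le> K" unfolding K_def
    using assms(1) v0 x(1) y(1) by (intro member_le_sum) (auto simp: less_imp_le)
  moreover have "0 < x v0 * y v0" using v0 x(1) by simp
  ultimately have "K > 0" by linarith
  moreover have "0 \<le> (m - l) * K" using D sum by linarith
  ultimately show "l \<le> m" by (simp add: zero_le_mult_iff)
  have z: "D = 0" "D' = 0" "D'' = 0" if "l = m" using D sum that by auto
  show 1: "adj_sum G y v = l * y v" if "l = m" "v \<in> ?V" for v
    using z(1)[OF that(1)] nn(1) assms(1) x(1)[OF that(2)] that(2) unfolding D_def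
    by (subst (asm) sum_nonneg_eq_0_iff) auto
  show "adj_sum H y v = l * y v" if "l = m" "v \<in> ?V" for v
    using z(2)[OF that(1)] nn(2) assms(1) x(1)[OF that(2)] that(2) 1[OF that] unfolding D'_def
    by (subst (asm) sum_nonneg_eq_0_iff) auto
  show "adj_sum H x v = l * x v" if "l = m" "v \<in> ?V" "0 < y v" for v
    using z(3)[OF that(1)] nn(3) assms(1) that unfolding D''_def
    by (subst (asm) sum_nonneg_eq_0_iff) auto
qed

lemma adj_sum_eq_0D:
  assumes "finite (pverts H)" "\<And>v. 0 \<le> y v" "adj_sum H y v = 0" "w \<in> pverts H" "(v, w) \<in> parcs H"
  shows "y w = 0"
proof -
  have "\<forall>w\<in>pverts H. of_bool ((v, w) \<in> parcs H) * y w = 0"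
    using assms(1,2,3) unfolding adj_sum_def by (subst (asm) sum_nonneg_eq_0_iff) auto
  then show ?thesis using assms(4,5) by fastforce
qed

text \<open>For a nonnegative eigenvector a zero entry forces zeros at all neighbours. Through the
  dominating vertex \<open>u\<close> it would reach \<open>v0\<close>.\<close>

lemma eigenvector_positive:
  assumes "finite (pverts H)" "sym (parcs H)"
    and u: "u \<in> pverts H" "\<And>v. v \<in> pverts H \<Longrightarrow> v \<noteq> u \<Longrightarrow> (u, v) \<in> parcs H"
    and y: "\<And>v. 0 \<le> y v" "\<And>v. v \<in> pverts H \<Longrightarrow> adj_sum H y v = l * y v"
    and v0: "v0 \<in> pverts H" "0 < y v0"
    and v: "v \<in> pverts H"
  shows "0 < y v"
proof (rule ccontr)
  have zero: "y b = 0" if "a \<in> pverts H" "y a = 0" "b \<in> pverts H" "(a, b) \<in> parcs H" for a b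
    using adj_sum_eq_0D[OF assms(1) y(1), where v = a and w = b] y(2)[of a] that by simp
  assume "\<not> 0 < y v"
  then have "y v = 0" using y(1)[of v] by linarith
  then have "y u = 0" using zero[OF v] u assms(2) v by (cases "v = u") (auto simp: sym_def)
  then have "y v0 = 0" using zero[OF u(1)] u(2) v0 by (cases "v0 = u") auto
  then show False using v0 by simp
qed

text \<open>Each missing arc would remove a positive summand.\<close>

lemma arcs_eq_if_adj_sum_eq:
  assumes "finite (pverts H)" "pverts G = pverts H" "parcs G \<subseteq> parcs H"
    and "parcs H \<subseteq> pverts H \<times> pverts H"
    and y: "\<And>v. v \<in> pverts H \<Longrightarrow> 0 < y v"
    and eq: "\<And>v. v \<in> pverts H \<Longrightarrow> adj_sum G y v = adj_sum H y v"
  shows "parcs G = parcs H"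
proof (rule equalityI[OF assms(3)], rule subrelI)
  fix v w assume vw: "(v, w) \<in> parcs H"
  then have V: "v \<in> pverts H" "w \<in> pverts H" using assms(4) by auto
  have "(\<Sum>w\<in>pverts H. (of_bool ((v, w) \<in> parcs H) - of_bool ((v, w) \<in> parcs G)) * y w) = 0"
    using eq[OF V(1)] by (simp add: adj_sum_def assms(2) left_diff_distrib sum_subtractf)
  moreover have "0 \<le> (of_bool ((v, w) \<in> parcs H) - of_bool ((v, w) \<in> parcs G)) * y w"
    if "w \<in> pverts H" for w
    using assms(3) y[OF that] by (auto simp: of_bool_def)
  ultimately have "(of_bool ((v, w) \<in> parcs H) - of_bool ((v, w) \<in> parcs G)) * y w = 0"
    using V(2) assms(1) by (simp add: sum_nonneg_eq_0_iff)
  then show "(v, w) \<in> parcs G" using vw y[OF V(2)] by (simp split: if_splits add: of_bool_def)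
qed

section \<open>Separated blocks\<close>

definition separator_graph :: "'a set \<Rightarrow> 'a set set \<Rightarrow> 'a pair_pre_digraph" where
  "separator_graph S P = \<lparr>pverts = S \<union> \<Union>P,
     parcs = {(u, v). u \<in> S \<union> \<Union>P \<and> v \<in> S \<union> \<Union>P \<and> u \<noteq> v \<and>
       (u \<in> S \<or> v \<in> S \<or> (\<exists>C\<in>P. u \<in> C \<and> v \<in> C))}\<rparr>"

lemma pverts_separator_graph [simp]: "pverts (separator_graph S P) = S \<union> \<Union>P"
  by (simp add: separator_graph_def)

lemma parcs_separator_graph_subset:
  "parcs (separator_graph S P) \<subseteq> pverts (separator_graph S P) \<times> pverts (separator_graph S P)"
  by (auto simp: separator_graph_def)

lemma sym_separator_graph: "sym (parcs (separator_graph S P))"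
  by (auto simp: separator_graph_def sym_def)

lemma adj_sum_eq_sum:
  "finite (pverts G) \<Longrightarrow> adj_sum G f v = sum f {w \<in> pverts G. (v, w) \<in> parcs G}"
  unfolding adj_sum_def of_bool_def by (simp add: sum.inter_filter if_distrib[of "\<lambda>x. x * _"] cong: if_cong)

text \<open>With total weight 1 on \<open>S\<close>, a constant value t on a block \<open>C\<close>
  must satisfy l t = 1 + (|C| - 1) t, hence t = 1 / (l + 1 - |C|). A vertex of \<open>S\<close> sees
  the total weight minus its own. The bound on \<open>card C\<close> keeps the denominators
  positive.\<close>

lemma separator_graph_weight:
  fixes l :: real
  assumes fin: "finite S" "finite (\<Union>P)" and S: "S \<noteq> {}" and P: "disjoint P" "S \<inter> \<Union>P = {}"
    and l: "\<And>C. C \<in> P \<Longrightarrow> real (card C) \<le> l"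
  shows "\<exists>x. (\<forall>v\<in>S \<union> \<Union>P. 0 < x v) \<and>
    (\<forall>v\<in>\<Union>P. adj_sum (separator_graph S P) x v = l * x v) \<and>
    (\<forall>v\<in>S. x v = 1 / card S \<and> adj_sum (separator_graph S P) x v
      = 1 + (\<Sum>C\<in>P. card C / (l + 1 - card C)) - 1 / card S)"
proof -
  let ?H = "separator_graph S P"
  define x where "x v = (if v \<in> S then 1 / real (card S) else 1 / (l + 1 - card (THE C. C \<in> P \<and> v \<in> C)))" for v
  have xS: "x v = 1 / card S" if "v \<in> S" for v using that by (simp add: x_def)
  have xC: "x v = 1 / (l + 1 - card C)" if "C \<in> P" "v \<in> C" for v C
  proof -
    have "v \<notin> S" using that P(2) by blast
    moreover have "(THE C. C \<in> P \<and> v \<in> C) = C"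
      using that P(1) by (intro the_equality) (auto simp: pairwise_def disjnt_def)
    ultimately show ?thesis by (simp add: x_def)
  qed
  have finC: "finite C" if "C \<in> P" for C using that fin(2) by (meson Union_upper finite_subset)
  have sumS: "sum x S = 1" using S fin by (simp add: xS)
  have sumC: "sum x C = card C / (l + 1 - card C)" if "C \<in> P" for C
    using xC[OF that] by simp
  have sumP: "sum x (\<Union>P) = (\<Sum>C\<in>P. card C / (l + 1 - card C))"
  proof -
    have "sum x (\<Union>P) = sum (sum x) P"
      using sum.Union_disjoint[of P x] P(1) finC by (simp add: pairwise_def disjnt_def)
    then show ?thesis by (simp add: sumC)
  qed
  have finV: "finite (pverts ?H)" using fin by simp
  show ?thesis
  proof (intro exI[of _ x] conjI ballI)
    show "0 < x v" if v: "v \<in> S \<union> \<Union>P" for v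
    proof (cases "v \<in> S")
      case True
      then show ?thesis using fin by (simp add: xS card_gt_0_iff) (use True in blast)
    next
      case False
      then obtain C where "C \<in> P" "v \<in> C" using v by blast
      then show ?thesis using xC l[of C] by simp
    qed
    show "adj_sum ?H x v = l * x v" if v: "v \<in> \<Union>P" for v
    proof -
      obtain C where C: "C \<in> P" "v \<in> C" using v by blast
      have vS: "v \<notin> S" using v P by blast
      have SC: "S \<inter> C = {}" using C(1) P by blast
      have uniq: "D = C" if "D \<in> P" "v \<in> D" for D
        using that C P(1) by (auto simp: pairwise_def disjnt_def)
      have block: "(\<exists>D\<in>P. v \<in> D \<and> w \<in> D) \<longleftrightarrow> w \<in> C" for w using C uniq by blast
      have "{w \<in> pverts ?H. (v, w) \<in> parcs ?H} = S \<union> (C - {v})"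
        using C(1) vS \<open>v \<in> \<Union>P\<close> block by (auto simp: separator_graph_def)
      then have "adj_sum ?H x v = sum x S + sum x (C - {v})"
        using finV finC[OF C(1)] fin(1) SC by (simp add: adj_sum_eq_sum) (subst sum.union_disjoint; auto)
      also have "\<dots> = 1 + (card C / (l + 1 - card C) - 1 / (l + 1 - card C))"
      proof -
        have "sum x (C - {v}) = sum x C - x v" using C(2) finC[OF C(1)] by (simp add: sum_diff1)
        then show ?thesis by (simp only: sumS sumC[OF C(1)] xC[OF C])
      qed
      also have "\<dots> = l * x v"
      proof -
        define d where "d = l + 1 - card C"
        have "0 < d" "l = d + card C - 1" using l[OF C(1)] by (auto simp: d_def)
        then have "1 + (card C / d - 1 / d) = l * (1 / d)" by (simp add: field_simps)
        then show ?thesis by (simp only: xC[OF C] d_def)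
      qed
      finally show ?thesis .
    qed
    show "x v = 1 / card S" if "v \<in> S" for v by (rule xS[OF that])
    show "adj_sum ?H x v = 1 + (\<Sum>C\<in>P. card C / (l + 1 - card C)) - 1 / card S" if "v \<in> S" for v
    proof -
      have "{w \<in> pverts ?H. (v, w) \<in> parcs ?H} = (S \<union> \<Union>P) - {v}"
        using that by (auto simp: separator_graph_def)
      then have "adj_sum ?H x v = sum x (S \<union> \<Union>P) - x v"
        using finV that by (simp add: adj_sum_eq_sum sum_diff1)
      also have "sum x (S \<union> \<Union>P) = 1 + (\<Sum>C\<in>P. card C / (l + 1 - card C))"
        using sum.union_disjoint[OF fin P(2), of x] sumS sumP by simp
      finally show ?thesis using xS[OF that] by simp
    qed
  qed
qed

text \<open>Here \<open>q\<close> is the size of the remaining block if there are exactly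
  \<open>card S + k\<close> blocks and all others are singletons. The last hypothesis is the
  condition on \<open>S\<close> for this extremal block structure, and
  \<open>block_sum_bound\<close> transfers it to \<open>P\<close>.\<close>

lemma rho_le_separator_bound:
  fixes l q :: real and G :: "'a pair_pre_digraph"
  assumes G: "pair_graph G" "parcs G \<subseteq> parcs (separator_graph S P)"
    and S: "S \<subseteq> pverts G" "S \<noteq> {}" and P: "partition_on (pverts G - S) P"
    and card: "card S + k \<le> card P" 
    and q: "q = real (card (pverts G)) - 2 * card S - k + 1" "q \<le> l"
    and l: "1 + ((real (card S) + k - 1) / l + q / (l + 1 - q)) \<le> (l + 1) / card S"
  shows "rho G \<le> l"
    and "rho G = l \<Longrightarrow> G = separator_graph S P \<and> (\<exists>C\<in>P. card C = q)"
proof -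
  let ?H = "separator_graph S P"
  have finV: "finite (pverts G)" using G(1) by (simp add: pair_graph_iff)
  have V: "S \<union> \<Union>P = pverts G" "S \<inter> \<Union>P = {}" and disj: "disjoint P"
    using P S by (auto simp: partition_on_def)
  have fin: "finite S" "finite (\<Union>P)" using finV V by (metis finite_Un)+
  have finP: "finite P" using fin(2) by (rule finite_UnionD)
  have finC: "finite C" if "C \<in> P" for C using that fin(2) by (meson Union_upper finite_subset)
  have pos: "1 \<le> card C" if "C \<in> P" for C
    using that finC[OF that] P by (metis One_nat_def Suc_leI card_gt_0_iff partition_onD3)
  have "card (\<Union>P) = sum card P"
    using disj finC by (intro card_Union_disjoint) auto
  moreover have "card (pverts G) = card S + card (\<Union>P)"
    using card_Un_disjoint[OF fin V(2)] V(1) by simp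
  ultimately have sum: "(\<Sum>C\<in>P. real (card C)) = real (card (pverts G)) - card S"
    by (metis add_diff_cancel_left' of_nat_add of_nat_sum)
  have s1: "1 \<le> card S" using S fin(1) by (simp add: Suc_leI card_gt_0_iff)
  let ?r = "real (card S) + k - 1"
  have Mr: "(\<Sum>C\<in>P. real (card C)) - ?r = q" by (simp add: sum q(1))
  \<comment> \<open>The other blocks have at least one vertex each, so no block exceeds
    \<open>q\<close>.\<close>
  have le: "real (card C) \<le> l" if C: "C \<in> P" for C
  proof -
    have "(\<Sum>C\<in>P - {C}. 1) \<le> (\<Sum>C\<in>P - {C}. real (card C))"
      using pos by (intro sum_mono) (simp add: Suc_leI)
    then have "real (card P) - 1 \<le> (\<Sum>C\<in>P. real (card C)) - card C"
      using C finP by (simp add: sum_diff1 card_Diff_singleton of_nat_diff card_gt_0_iff Suc_leI)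
    then show ?thesis using Mr q(2) card by linarith
  qed
  define \<Sigma> where "\<Sigma> = (\<Sum>C\<in>P. card C / (l + 1 - card C))"
  have bound: "\<Sigma> < ?r / l + q / (l + 1 - q) \<or> \<Sigma> = ?r / l + q / (l + 1 - q) \<and> (\<exists>C\<in>P. card C = q)"
    using block_sum_bound[of P "\<lambda>C. real (card C)" ?r l] finP pos card s1 q(2)
    unfolding Mr \<Sigma>_def by (simp add: Suc_leI)
  obtain x where x: "\<And>v. v \<in> S \<union> \<Union>P \<Longrightarrow> 0 < x v"
    "\<And>v. v \<in> \<Union>P \<Longrightarrow> adj_sum ?H x v = l * x v" "\<And>v. v \<in> S \<Longrightarrow> x v = 1 / card S"
    "\<And>v. v \<in> S \<Longrightarrow> adj_sum ?H x v = 1 + \<Sigma> - 1 / card S"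
    using separator_graph_weight[OF fin S(2) disj V(2) le] unfolding \<Sigma>_def[symmetric] by blast
  have sub: "adj_sum ?H x v \<le> l * x v" if "v \<in> pverts ?H" for v
  proof (cases "v \<in> S")
    case True
    have "1 + \<Sigma> \<le> (l + 1) / card S" using bound l by linarith
    then show ?thesis using x(3,4)[OF True] by (simp add: add_divide_distrib)
  next
    case False
    then show ?thesis using x(2)[of v] that by auto
  qed
  obtain y where y: "\<And>v. 0 \<le> y v" "\<exists>v\<in>pverts G. 0 < y v"
    "\<And>v. v \<in> pverts G \<Longrightarrow> rho G * y v \<le> adj_sum G y v"
    using rho_subeigenvector[OF finV] S by blast
  then obtain v0 where v0: "v0 \<in> pverts G" "0 < y v0" by blast
  have H: "finite (pverts ?H)" "pverts G = pverts ?H" using V finV by auto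
  note compare = subgraph_eigen_compare[OF H G(2) sym_separator_graph, of x l y "rho G" v0]
  show "rho G \<le> l"
    using compare(1) x(1) sub y(1,3) v0 H(2) by simp
  assume eq: "rho G = l"
  have Gy: "adj_sum G y v = l * y v" and Hy: "adj_sum ?H y v = l * y v" if "v \<in> pverts ?H" for v
    using compare(2,3) x(1) sub y(1,3) v0 H(2) eq that by auto
  obtain u where u: "u \<in> S" using S by blast
  \<comment> \<open>Every vertex of \<open>S\<close> is adjacent to all others, so it can serve as
    the dominating vertex.\<close>
  have yp: "0 < y v" if "v \<in> pverts ?H" for v
  proof (rule eigenvector_positive[OF H(1) sym_separator_graph, of u y l v0])
    show "(u, w) \<in> parcs ?H" if "w \<in> pverts ?H" "w \<noteq> u" for w
      using that u by (auto simp: separator_graph_def)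
  qed (use u y(1) Hy v0 H(2) that in auto)
  have "parcs G = parcs ?H"
    using arcs_eq_if_adj_sum_eq[OF H G(2) parcs_separator_graph_subset, of y] yp Gy Hy by simp
  then have "G = ?H" using H(2) by simp
  \<comment> \<open>Since \<open>y\<close> is positive at \<open>u\<close>, the weight
    \<open>x\<close> is tight there too; this makes the block sum attain its maximum and yields a
    block of size \<open>q\<close>.\<close>
  moreover have "adj_sum ?H x u = l * x u"
    using compare(4)[of u] x(1) sub y(1,3) v0 H(2) eq u yp[of u] by auto
  then have "1 + \<Sigma> = (l + 1) / card S" using x(3,4)[OF u] by (simp add: add_divide_distrib)
  then have "\<exists>C\<in>P. card C = q" using bound l by linarith
  ultimately show "G = ?H \<and> (\<exists>C\<in>P. card C = q)" by blast
qed

section \<open>Isomorphisms and the extremal graph as a separator graph\<close>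

lemma graph_iso_if_bij_betw:
  assumes "bij_betw f (pverts G) (pverts H)"
    and "parcs G \<subseteq> pverts G \<times> pverts G" "parcs H \<subseteq> pverts H \<times> pverts H"
    and "\<And>u v. u \<in> pverts G \<Longrightarrow> v \<in> pverts G \<Longrightarrow> (u, v) \<in> parcs G \<longleftrightarrow> (f u, f v) \<in> parcs H"
  shows "graph_iso G H"
proof -
  let ?f = "\<lparr>iso_verts = f, iso_arcs = map_prod f f, iso_head = snd, iso_tail = fst\<rparr>"
  have inj: "inj_on f (pverts G)" and img: "f ` pverts G = pverts H"
    using assms(1) by (auto simp: bij_betw_def)
  have "inj_on (map_prod f f) (parcs G)"
    using map_prod_inj_on[OF inj inj] assms(2) by (rule inj_on_subset)
  moreover have "pair_wf_digraph G" using assms(2) by unfold_locales auto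
  ultimately have "pre_digraph.digraph_isomorphism (with_proj G) ?f"
    using inj by (simp add: pre_digraph.digraph_isomorphism_def wf_digraph_wp_iff)
  moreover have "map_prod f f ` parcs G = parcs H"
  proof
    show "map_prod f f ` parcs G \<subseteq> parcs H" using assms(2,4) by auto
    show "parcs H \<subseteq> map_prod f f ` parcs G"
    proof (rule subrelI)
      fix a b assume ab: "(a, b) \<in> parcs H"
      then obtain u v where "u \<in> pverts G" "v \<in> pverts G" "a = f u" "b = f v"
        using assms(3) img by blast
      then show "(a, b) \<in> map_prod f f ` parcs G"
        using ab assms(4) by (intro image_eqI[of _ _ "(u, v)"]) auto
    qed
  qed
  then have "with_proj H = app_iso ?f (with_proj G)"
    using img by (simp add: app_iso_def with_proj_def)
  ultimately show ?thesis by (auto simp: digraph_iso_def)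
qed


text \<open>The nested sum type hides three classes: the two join vertices, the large clique and the
  isolated vertices. In this flat form adjacency depends only on the classes.\<close>

lemma extremal_graph_parts:
  shows "pverts (extremal_graph n k)
      = Inl ` {..<2} \<union> (Inr ` Inr ` {..<n - k - 3} \<union> Inr ` Inl ` ({..<k + 1} \<times> {0}))"
    and "parcs (extremal_graph n k) = {(u, v). u \<in> pverts (extremal_graph n k) \<and>
      v \<in> pverts (extremal_graph n k) \<and> u \<noteq> v \<and> (u \<in> Inl ` {..<2} \<or> v \<in> Inl ` {..<2} \<or>
        u \<in> Inr ` Inr ` {..<n - k - 3} \<and> v \<in> Inr ` Inr ` {..<n - k - 3})}"
proof -
  show V: "pverts (extremal_graph n k)
      = Inl ` {..<2} \<union> (Inr ` Inr ` {..<n - k - 3} \<union> Inr ` Inl ` ({..<k + 1} \<times> {0}))"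
    by (auto simp: extremal_graph_def graph_join_def disjoint_union_def copies_def complete_graph_def)
  have "(u, v) \<in> parcs (extremal_graph n k) \<longleftrightarrow> u \<in> pverts (extremal_graph n k) \<and>
      v \<in> pverts (extremal_graph n k) \<and> u \<noteq> v \<and> (u \<in> Inl ` {..<2} \<or> v \<in> Inl ` {..<2} \<or>
        u \<in> Inr ` Inr ` {..<n - k - 3} \<and> v \<in> Inr ` Inr ` {..<n - k - 3})" for u v
    unfolding V
    by (cases u rule: sum.exhaust; cases v rule: sum.exhaust;
        cases "projr u" rule: sum.exhaust; cases "projr v" rule: sum.exhaust)
      (auto simp: extremal_graph_def graph_join_def disjoint_union_def copies_def complete_graph_def)
  then show "parcs (extremal_graph n k) = {(u, v). u \<in> pverts (extremal_graph n k) \<and>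
      v \<in> pverts (extremal_graph n k) \<and> u \<noteq> v \<and> (u \<in> Inl ` {..<2} \<or> v \<in> Inl ` {..<2} \<or>
        u \<in> Inr ` Inr ` {..<n - k - 3} \<and> v \<in> Inr ` Inr ` {..<n - k - 3})}"
    by auto
qed

lemma extremal_graph_eq_separator_graph:
  "extremal_graph n k = separator_graph (Inl ` {..<2})
    (insert (Inr ` Inr ` {..<n - k - 3}) ((\<lambda>v. {v}) ` Inr ` Inl ` ({..<k + 1} \<times> {0})))"
  (is "_ = separator_graph ?S ?P")
proof -
  have "pverts (extremal_graph n k) = pverts (separator_graph ?S ?P)"
    unfolding extremal_graph_parts(1) by simp
  moreover have "parcs (extremal_graph n k) = parcs (separator_graph ?S ?P)"
    unfolding extremal_graph_parts separator_graph_def by auto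
  ultimately show ?thesis by simp
qed

text \<open>At a root of the quotient equation the weight of \<open>separator_graph_weight\<close>
  satisfies the eigenvalue equation on \<open>S\<close> as well, so it is an eigenvector.\<close>

lemma rho_extremal_graph_ge:
  fixes l :: real
  assumes n: "n \<ge> k + 4" and l: "real (n - k - 3) \<le> l" "1 \<le> l"
    and root: "1 + ((real k + 1) / l + real (n - k - 3) / (l + 1 - real (n - k - 3))) = (l + 1) / 2"
  shows "l \<le> rho (extremal_graph n k)"
proof -
  define S :: "(nat + (nat \<times> nat) + nat) set" where "S = Inl ` {..<2}"
  define C :: "(nat + (nat \<times> nat) + nat) set" where "C = Inr ` Inr ` {..<n - k - 3}"
  define R :: "(nat + (nat \<times> nat) + nat) set" where "R = Inr ` Inl ` ({..<k + 1} \<times> {0})"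
  define P where "P = insert C ((\<lambda>v. {v}) ` R)"
  have E: "extremal_graph n k = separator_graph S P"
    unfolding extremal_graph_eq_separator_graph S_def P_def C_def R_def ..
  have cards: "card S = 2" "card C = n - k - 3" "card R = k + 1"
    by (simp_all add: S_def C_def R_def card_image inj_on_def)
  have fin: "finite S" "finite C" "finite R" by (simp_all add: S_def C_def R_def)
  have UP: "\<Union>P = C \<union> R" by (auto simp: P_def)
  have CR: "C \<inter> R = {}" by (auto simp: C_def R_def)
  \<comment> \<open>The sum ranges over a set of blocks, so the clique has to differ from every
    singleton block, even if it has one vertex itself.\<close>
  have "C \<noteq> {}" using n cards(2) by auto
  then have "C \<notin> (\<lambda>v. {v}) ` R" using CR by auto
  moreover have "inj_on (\<lambda>v. {v}) R" by (simp add: inj_on_def)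
  ultimately have sumP: "(\<Sum>D\<in>P. card D / (l + 1 - card D))
      = real (n - k - 3) / (l + 1 - real (n - k - 3)) + (real k + 1) / l"
    using fin by (simp add: P_def sum.reindex cards)
  have "disjoint P" using CR by (auto simp: P_def pairwise_def disjnt_def)
  moreover have "S \<inter> \<Union>P = {}" unfolding UP by (auto simp: S_def C_def R_def)
  moreover have "real (card D) \<le> l" if "D \<in> P" for D
    using that l cards by (auto simp: P_def)
  moreover have "S \<noteq> {}" "finite (\<Union>P)" using cards fin unfolding UP by auto
  ultimately obtain x where x: "\<forall>v\<in>S \<union> \<Union>P. 0 < x v"
      "\<forall>v\<in>\<Union>P. adj_sum (separator_graph S P) x v = l * x v"
      "\<forall>v\<in>S. x v = 1 / card S \<and> adj_sum (separator_graph S P) x v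
        = 1 + (\<Sum>D\<in>P. card D / (l + 1 - card D)) - 1 / card S"
    using separator_graph_weight[of S P l] fin(1) by blast
  obtain u where u: "u \<in> S" using \<open>S \<noteq> {}\<close> by blast
  have "adj_sum (extremal_graph n k) x v = l * x v" if "v \<in> pverts (extremal_graph n k)" for v
  proof (cases "v \<in> S")
    case True
    have "adj_sum (extremal_graph n k) x v = (l + 1) / 2 - 1 / 2"
      using x(3)[rule_format, OF True] root by (simp add: E sumP cards)
    also have "\<dots> = l * (1 / 2)" by (simp add: field_simps)
    also have "1 / 2 = x v" using x(3)[rule_format, OF True] by (simp add: cards)
    finally show ?thesis .
  next
    case False
    then show ?thesis using x(2) that by (auto simp: E)
  qed
  moreover have "x u \<noteq> 0" "u \<in> pverts (extremal_graph n k)" using x(1) u by (force simp: E)+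
  moreover have "finite (pverts (extremal_graph n k))" using fin by (simp add: E UP)
  ultimately have "\<bar>l\<bar> \<le> rho (extremal_graph n k)" by (intro eigenvalue_le_rho)
  then show ?thesis by linarith
qed

text \<open>Outside \<open>C\<close> there remain \<open>k + 1\<close> vertices for at least
  \<open>k + 1\<close> nonempty blocks, so these are singletons. Then all three classes have the
  right sizes, and class-wise bijections combine to an isomorphism.\<close>

lemma separator_graph_iso_extremal_graph:
  assumes fin: "finite S" "finite (\<Union>P)" and S: "card S = 2" "S \<inter> \<Union>P = {}"
    and P: "partition_on (\<Union>P) P" "k + 2 \<le> card P"
    and C: "C \<in> P" "card C = n - k - 3" and n: "card (S \<union> \<Union>P) = n" "n \<ge> k + 4"
  shows "graph_iso (separator_graph S P) (extremal_graph n k)"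
proof -
  define R where "R = \<Union>P - C"
  have finC: "finite C" and UP: "\<Union>P = C \<union> R" "C \<inter> R = {}"
    using C fin(2) by (auto simp: R_def intro: finite_subset)
  have finP: "finite P" using fin(2) by (rule finite_UnionD)
  have "n = card S + card (\<Union>P)" using n(1) card_Un_disjoint[OF fin S(2)] by simp
  moreover have "card (\<Union>P) = card C + card R"
    using UP fin(2) finC by (metis card_Un_disjoint finite_Un)
  ultimately have cardR: "card R = k + 1" using S C n(2) by simp
  have R: "finite R" using fin(2) by (simp add: R_def)
  have single: "u = v" if "D \<in> P" "D \<noteq> C" "u \<in> D" "v \<in> D" for D u v
  proof -
    have DR: "D' \<subseteq> R" "D' \<noteq> {}" if "D' \<in> P - {C}" for D'
      using that C(1) P(1) by (auto simp: R_def partition_on_def pairwise_def disjnt_def)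
    have UR: "\<Union>(P - {C}) = R" by (rule equalityI) (use DR(1) in blast, auto simp: R_def)
    have pos: "1 \<le> card D'" if "D' \<in> P - {C}" for D'
      using DR[OF that] R by (metis One_nat_def Suc_leI card_gt_0_iff finite_subset)
    have "card R = sum card (P - {C})" unfolding UR[symmetric]
      using P(1) finite_subset[OF DR(1) R]
      by (intro card_Union_disjoint) (auto simp: partition_on_def intro: pairwise_subset)
    also have "\<dots> = card D + sum card (P - {C} - {D})"
      using that finP by (intro sum.remove) auto
    also have "\<dots> \<ge> card D + (\<Sum>D'\<in>P - {C} - {D}. 1)"
      using pos by (intro add_left_mono sum_mono) auto
    finally have "card D + card (P - {C} - {D}) \<le> k + 1" by (simp add: cardR)
    moreover have "card (P - {C} - {D}) = card P - 2"
      using that C(1) finP by (simp add: card_Diff_singleton)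
    ultimately have "card D \<le> 1" using P(2) by linarith
    moreover have "finite D" using DR(1)[of D] that R by (auto intro: finite_subset)
    ultimately show ?thesis using that by (auto simp: card_le_Suc0_iff_eq)
  qed
  have arcs: "parcs (separator_graph S P) = {(u, v). u \<in> S \<union> \<Union>P \<and> v \<in> S \<union> \<Union>P \<and> u \<noteq> v \<and>
      (u \<in> S \<or> v \<in> S \<or> u \<in> C \<and> v \<in> C)}"
    using single C(1) unfolding separator_graph_def by (auto; metis)
  define S' :: "(nat + (nat \<times> nat) + nat) set" where "S' = Inl ` {..<2}"
  define C' :: "(nat + (nat \<times> nat) + nat) set" where "C' = Inr ` Inr ` {..<n - k - 3}"
  define R' :: "(nat + (nat \<times> nat) + nat) set" where "R' = Inr ` Inl ` ({..<k + 1} \<times> {0})"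
  have cards': "card S' = 2" "card C' = n - k - 3" "card R' = k + 1"
    by (simp_all add: S'_def C'_def R'_def card_image inj_on_def)
  have fin': "finite S'" "finite C'" "finite R'" by (simp_all add: S'_def C'_def R'_def)
  have disj': "S' \<inter> (C' \<union> R') = {}" "C' \<inter> R' = {}" by (auto simp: S'_def C'_def R'_def)
  obtain f1 f2 f3 where f: "bij_betw f1 S S'" "bij_betw f2 C C'" "bij_betw f3 R R'"
    using finite_same_card_bij[OF fin(1) fin'(1)] finite_same_card_bij[OF finC fin'(2)]
      finite_same_card_bij[OF R fin'(3)] S C cardR cards' by auto
  define f where "f v = (if v \<in> S then f1 v else if v \<in> C then f2 v else f3 v)" for v
  have SP: "S \<inter> C = {}" "S \<inter> R = {}" using S(2) UP by auto
  have fS: "bij_betw f S S'" using f(1) by (rule bij_betw_cong[THEN iffD1, rotated]) (simp add: f_def)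
  have fC: "bij_betw f C C'"
    using f(2) by (rule bij_betw_cong[THEN iffD1, rotated]) (use SP in \<open>auto simp: f_def\<close>)
  have fR: "bij_betw f R R'"
    using f(3) by (rule bij_betw_cong[THEN iffD1, rotated]) (use SP UP in \<open>auto simp: f_def\<close>)
  have bij: "bij_betw f (S \<union> (C \<union> R)) (S' \<union> (C' \<union> R'))"
    by (intro bij_betw_combine fS fC fR disj')
  have mem: "f v \<in> S' \<longleftrightarrow> v \<in> S" "f v \<in> C' \<longleftrightarrow> v \<in> C" if "v \<in> S \<union> (C \<union> R)" for v
    using that fS fC fR disj' SP UP(2) by (auto dest!: bij_betw_apply)
  have E: "pverts (extremal_graph n k) = S' \<union> (C' \<union> R')"
    "parcs (extremal_graph n k) = {(u, v). u \<in> S' \<union> (C' \<union> R') \<and> v \<in> S' \<union> (C' \<union> R') \<and> u \<noteq> v \<and>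
      (u \<in> S' \<or> v \<in> S' \<or> u \<in> C' \<and> v \<in> C')}"
    unfolding S'_def C'_def R'_def using extremal_graph_parts[of n k] by simp_all
  show ?thesis
  proof (rule graph_iso_if_bij_betw[of f])
    show "bij_betw f (pverts (separator_graph S P)) (pverts (extremal_graph n k))"
      using bij by (simp add: E UP)
    show "(u, v) \<in> parcs (separator_graph S P) \<longleftrightarrow> (f u, f v) \<in> parcs (extremal_graph n k)"
      if "u \<in> pverts (separator_graph S P)" "v \<in> pverts (separator_graph S P)" for u v
    proof -
      have uv: "u \<in> S \<union> (C \<union> R)" "v \<in> S \<union> (C \<union> R)" using that by (auto simp: UP)
      have "f u \<in> S' \<union> (C' \<union> R')" "f v \<in> S' \<union> (C' \<union> R')" using bij uv bij_betw_apply by metis+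
      moreover have "f u = f v \<longleftrightarrow> u = v" using bij uv by (metis bij_betw_def inj_on_eq_iff)
      ultimately show ?thesis using uv mem[OF uv(1)] mem[OF uv(2)] by (simp add: arcs E UP)
    qed
  qed (auto simp: arcs E)
qed

section \<open>From a missing matching to a separator\<close>

lemma partition_on_card_le:
  assumes "finite A" "partition_on A P"
  shows "card P \<le> card A"
proof -
  have A: "A = \<Union>P" "disjoint P" "{} \<notin> P" using assms(2) by (auto simp: partition_on_def)
  have fin: "finite C" if "C \<in> P" for C using that assms(1) A(1) by (auto intro: finite_subset)
  then have "(\<Sum>C\<in>P. 1) \<le> sum card P"
    using A(3) by (intro sum_mono) (metis One_nat_def Suc_leI card_gt_0_iff)
  also have "\<dots> = card A" unfolding A(1) using A(2) fin by (intro card_Union_disjoint[symmetric]) auto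
  finally show ?thesis by simp
qed

lemma card_edge:
  assumes "pair_graph G" "e \<in> edges G"
  shows "card e = 2" "e \<subseteq> pverts G"
proof -
  obtain u v where e: "e = {u, v}" "(u, v) \<in> parcs G" using assms(2) by (auto simp: edges_def)
  have "irrefl (parcs G)" "parcs G \<subseteq> pverts G \<times> pverts G" using assms(1) by (auto simp: pair_graph_iff)
  then have "u \<noteq> v" "u \<in> pverts G" "v \<in> pverts G" using e(2) by (auto simp: irrefl_def)
  then show "card e = 2" "e \<subseteq> pverts G" using e(1) by auto
qed

text \<open>With p = (n - k) / 2, a matching of size p - 1 avoiding the ends of \<open>e\<close>
  would extend by \<open>e\<close> to a forbidden one. So \<open>tutte_berge\<close> applies to the
  graph without these ends with bound p - 2, and \<open>e\<close> is added to the resulting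
  \<open>T\<close>.\<close>

lemma separator_if_edge_not_in_matching:
  assumes G: "pair_graph G" and n: "k + 4 \<le> card (pverts G)" "even (card (pverts G) - k)"
    and e: "e \<in> edges G"
    and no: "\<nexists>M. matching G M \<and> card M = (card (pverts G) - k) div 2 \<and> e \<in> M"
  shows "\<exists>S P. S \<subseteq> pverts G \<and> 2 \<le> card S \<and> partition_on (pverts G - S) P \<and>
    parcs G \<subseteq> parcs (separator_graph S P) \<and> card S + k \<le> card P"
proof -
  let ?V = "pverts G"
  define p where "p = (card ?V - k) div 2"
  have p: "2 * p + k = card ?V" "2 \<le> p" using n by (auto simp: p_def)
  have fin: "finite ?V" using G by (simp add: pair_graph_iff)
  have E2: "\<forall>f\<in>edges G. card f = 2" using card_edge[OF G] by blast
  have small: "card M \<le> p - 2" if M: "matching_within (edges G) (?V - e) M" for M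
  proof (rule ccontr)
    assume "\<not> card M \<le> p - 2"
    then have "p - 1 \<le> card M" by linarith
    then obtain N where N: "N \<subseteq> M" "card N = p - 1" "finite N" using obtain_subset_with_card_n by metis
    have disj: "f \<inter> e = {}" if "f \<in> N" for f
      using that N(1) M by (auto simp: matching_within_def)
    have "e \<notin> N" using disj[of e] E2 e by auto
    then have "card (insert e N) = p" using N p(2) by simp
    moreover have "disjoint N" using N(1) M pairwise_subset by (auto simp: matching_within_def)
    then have "f \<inter> g = {}" if "f \<in> N" "g \<in> N" "f \<noteq> g" for f g
      using that by (metis disjnt_def pairwiseD)
    then have "matching G (insert e N)"
      using N(1) M e disj by (auto simp: matching_def matching_within_def Int_commute)
    ultimately show False using no by (auto simp: p_def)
  qed
  have "finite (?V - e)" using fin by simp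
  then have "\<exists>T P. T \<subseteq> ?V - e \<and> partition_on (?V - e - T) P \<and>
      (\<forall>f\<in>edges G. f \<subseteq> ?V - e - T \<longrightarrow> (\<exists>C\<in>P. f \<subseteq> C)) \<and>
      card T + card (?V - e) \<le> card P + 2 * (p - 2)"
    using E2 small by (rule tutte_berge)
  then obtain T P where T: "T \<subseteq> ?V - e"
    and P: "partition_on (?V - e - T) P"
    and arcs: "\<forall>f\<in>edges G. f \<subseteq> ?V - e - T \<longrightarrow> (\<exists>C\<in>P. f \<subseteq> C)"
    and card: "card T + card (?V - e) \<le> card P + 2 * (p - 2)"
    by (elim exE conjE) (rule that)
  let ?S = "T \<union> e"
  have eq: "?V - e - T = ?V - ?S" by blast
  have fe: "finite e" "card e = 2" "e \<subseteq> ?V" using card_edge[OF G e] fin by (auto intro: finite_subset)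
  have "finite T" using T fin by (auto intro: finite_subset)
  then have cS: "card ?S = card T + 2" using T fe by (subst card_Un_disjoint) auto
  have "card (?V - e) + 2 = card ?V" using fe fin card_Diff_subset[of e ?V] card_mono[of ?V e] by simp
  \<comment> \<open>With n = 2p + k, the inequality |T| + n - 2 <= |P| + 2(p - 2) becomes |T| + 2 +
    k <= |P|.\<close>
  then have "card ?S + k \<le> card P" using card p cS by linarith
  moreover have "parcs G \<subseteq> parcs (separator_graph ?S P)"
  proof (rule subrelI)
    fix u v assume uv: "(u, v) \<in> parcs G"
    then have V: "u \<in> ?V" "v \<in> ?V" and "u \<noteq> v" using G by (auto simp: pair_graph_iff irrefl_def)
    have UP: "?S \<union> \<Union>P = ?V" using P T fe unfolding eq by (auto simp: partition_on_def)
    have "\<exists>C\<in>P. u \<in> C \<and> v \<in> C" if "u \<notin> ?S" "v \<notin> ?S"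
    proof -
      have "{u, v} \<in> edges G" using uv by (auto simp: edges_def)
      then show ?thesis using arcs V that by fastforce
    qed
    then show "(u, v) \<in> parcs (separator_graph ?S P)"
      using V UP \<open>u \<noteq> v\<close> by (auto simp: separator_graph_def)
  qed
  ultimately show ?thesis
    using T P fe cS unfolding eq by (intro exI[of _ ?S] exI[of _ P]) auto
qed

section \<open>Comparing the separator bound with the extremal graph\<close>

theorem theorem1p1:
  fixes k n :: nat and G :: "'a pair_pre_digraph"
  assumes "pair_graph G"
    and "card (pverts G) = n"
    and "n \<ge> 5 * k + 6"
    and "[n = k] (mod 2)"
    and "rho G \<ge> rho (extremal_graph n k)"
    and "\<not> graph_iso G (extremal_graph n k)"
  shows "\<forall>e \<in> edges G. \<exists>M. matching G M \<and> card M = (n - k) div 2 \<and> e \<in> M"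
proof (rule ccontr)
  assume "\<not> (\<forall>e \<in> edges G. \<exists>M. matching G M \<and> card M = (n - k) div 2 \<and> e \<in> M)"
  then obtain e where e: "e \<in> edges G"
    "\<nexists>M. matching G M \<and> card M = (card (pverts G) - k) div 2 \<and> e \<in> M"
    using assms(2) by blast
  have even: "even (n - k)"
    using assms(4) by (simp add: cong_def even_diff_nat) (metis mod_eq_0_iff_dvd even_iff_mod_2_eq_zero)
  obtain S P where S: "S \<subseteq> pverts G" "2 \<le> card S" and P: "partition_on (pverts G - S) P"
    and arcs: "parcs G \<subseteq> parcs (separator_graph S P)" and card: "card S + k \<le> card P"
    using separator_if_edge_not_in_matching[OF assms(1) _ _ e] even assms(2,3) by auto
  have fin: "finite (pverts G)" using assms(1) by (simp add: pair_graph_iff)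
  have S0: "S \<noteq> {}" using S(2) by auto
  have UP: "\<Union>P = pverts G - S" using P by (simp add: partition_on_def)
  have finS: "finite S" "finite (\<Union>P)" using S(1) fin UP by (auto intro: finite_subset)
  \<comment> \<open>The at least \<open>card S + k\<close> nonempty blocks share n -
    \<open>card S\<close> vertices.\<close>
  have nS: "2 * card S + k \<le> n"
  proof -
    have "card P \<le> card (\<Union>P)"
      using P finS(2) unfolding UP by (rule partition_on_card_le[rotated])
    moreover have "card (\<Union>P) + card S = n"
      using UP S(1) finS fin assms(2) card_mono[OF fin S(1)] by (simp add: card_Diff_subset)
    ultimately show ?thesis using card by linarith
  qed
  \<comment> \<open>The join vertices and the large clique form a complete graph on n - k - 1
    vertices, whose spectral radius is \<open>m\<close>.\<close>
  define m where "m = real n - real k - 2"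
  define q where "q = real (card (pverts G)) - 2 * card S - k + 1"
  have q: "q = m - 2 * card S + 3" using assms(2) by (simp add: q_def m_def)
  have m: "4 * real k + 4 \<le> m" using assms(3) by (simp add: m_def)
  have Sm: "2 * real (card S) \<le> m + 2" using nS by (simp add: m_def)
  \<comment> \<open>For n = 6 and \<open>card S = 3\<close> the separator condition reads a^2 - 2a -
    9 >= 0, that is, a >= 1 + sqrt 10 = 4.16..., so a = m = 4 fails. The root for the extremal graph
    is 4.201..., and 21/5 lies between the two.\<close>
  define a :: real where "a = (if n = 6 then 21 / 5 else m)"
  have k0: "k = 0" "m = 4" if "n = 6" using that assms(3) by (auto simp: m_def)
  have a: "m \<le> a" "a \<le> m + 1" by (auto simp: a_def k0)
  have "(a + 1) / 2 < 1 + ((real k + 1) / a + (m - 1) / (a + 1 - (m - 1)))"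
  proof (cases "n = 6")
    case True
    then show ?thesis by (simp add: a_def k0)
  next
    case False
    \<comment> \<open>At a = \<open>m\<close> the right side exceeds (m + 1) / 2 by exactly (k + 1)
      / m.\<close>
    have "(m - 1) / (m + 1 - (m - 1)) = (m - 1) / 2" by simp
    moreover have "0 < (real k + 1) / m" using m by simp
    ultimately show ?thesis using False unfolding a_def by (simp add: add_divide_distrib diff_divide_distrib)
  qed
  then obtain l where l: "a < l" "1 + ((real k + 1) / l + (m - 1) / (l + 1 - (m - 1))) = (l + 1) / 2"
    using quotient_root_exists[OF _ m a] by auto
  have m1: "real (n - k - 3) = m - 1" using assms(3) by (simp add: m_def of_nat_diff)
  have "l \<le> rho (extremal_graph n k)"
  proof (rule rho_extremal_graph_ge)
    show "k + 4 \<le> n" using assms(3) by simp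
    show "real (n - k - 3) \<le> l" "1 \<le> l" unfolding m1 using l(1) a m by linarith+
    show "1 + ((real k + 1) / l + real (n - k - 3) / (l + 1 - real (n - k - 3))) = (l + 1) / 2"
      using l(2) by (simp only: m1)
  qed
  then have lG: "l \<le> rho G" using assms(5) by simp
  note bound = rho_le_separator_bound[OF assms(1) arcs S(1) S0 P card q_def]
  show False
  proof (cases "card S = 2")
    case True
    have qm: "q = m - 1" using q True by simp
    \<comment> \<open>For \<open>card S = 2\<close> the separator condition is the root equation
      itself, so \<open>rho G\<close> equals \<open>l\<close> and the equality case applies.\<close>
    have "q \<le> l" and eq: "1 + ((real (card S) + k - 1) / l + q / (l + 1 - q)) \<le> (l + 1) / card S"
      using l a True unfolding qm by (auto simp: add.commute)
    from bound[OF this] lG have G: "G = separator_graph S P" and "\<exists>C\<in>P. real (card C) = q" by auto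
    then obtain C where "C \<in> P" "card C = n - k - 3" unfolding qm m1[symmetric] by auto
    moreover have "S \<inter> \<Union>P = {}" "S \<union> \<Union>P = pverts G" using UP S(1) by auto
    ultimately have "graph_iso (separator_graph S P) (extremal_graph n k)"
      using finS True P UP card assms(2,3) by (intro separator_graph_iso_extremal_graph) auto
    then show False using G assms(6) by simp
  next
    case False
    then have s3: "3 \<le> card S" using S(2) by linarith
    have qa: "q \<le> a" using q a s3 by simp
    \<comment> \<open>For larger \<open>S\<close> the condition holds already at \<open>a\<close>,
      which gives rho(G) <= a < l <= rho(G).\<close>
    have "1 + ((real (card S) + k - 1) / a + q / (a + 1 - q)) \<le> (a + 1) / card S"
    proof (cases "n = 6")
      case True
      then have "card S = 3" using s3 nS by simp
      then show ?thesis using True by (simp add: q a_def k0)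
    next
      case False
      \<comment> \<open>For k = 0 parity and n > 6 give n >= 8; for k >= 1 already n >= 11. Either
        way \<open>m\<close> is at least 6.\<close>
      have "n \<noteq> 7" using even assms(3) by (cases "k = 0") auto
      then have "6 \<le> m" using False assms(3) by (cases "k = 0") (auto simp: m_def)
      moreover have "card S = 3 \<or> 4 \<le> card S" using s3 by linarith
      then have "real (card S) = 3 \<or> 4 \<le> real (card S)" by auto
      moreover have "a + 1 - q = 2 * real (card S) - 2" using False by (simp add: q a_def)
      ultimately show ?thesis
        using large_separator_bound[of "card S" m k] s3 Sm m False unfolding q by (simp add: a_def)
    qed
    from bound(1)[OF qa this] lG l(1) show False by linarith
  qed
qed

end
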